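(* Assume that the matrices $\Gamma_{k+1}$ and $Q_{uu}^{(k)}$ defined below are invertible for all $k=t,\dots,T-1$. Let $V_k, v_k$ be the solutions of the backward recursion, for $k=T-1,\dots,t$, \begin{align*} \Gamma_{k+1} &= I_{n_x} - \mu V_{k+1} Q_{k+1},\\ Q_{uu}^{(k)} &= \bar\ell^{uu}_k + {f^u_k}^T \Gamma_{k+1}^{-1} V_{k+1} f^u_k,\\ Q_{ux}^{(k)} &= \bar\ell^{ux}_k + {f^u_k}^T \Gamma_{k+1}^{-1} V_{k+1} f^x_k,\\ Q_{u}^{(k)} &= \ell^{u}_k + {f^u_k}^T \Gamma_{k+1}^{-1}\left(v_{k+1} - V_{k+1} w^i_{k+1}\right),\\ G_k &= -(Q_{uu}^{(k)})^{-1} Q_{ux}^{(k)},\qquad g_k = -(Q_{uu}^{(k)})^{-1} Q_u^{(k)},\\ V_k &= \bar\ell^{xx}_k + {f^x_k}^T \Gamma_{k+1}^{-1} V_{k+1} f^x_k + {Q_{ux}^{(k)}}^T G_k,\\ v_k &= \ell^x_k + {f^x_k}^T \Gamma_{k+1}^{-1}\left(v_{k+1} - V_{k+1} w^i_{k+1}\right) + {Q_{ux}^{(k)}}^T g_k, \end{align*} with terminal condition $V_T = \ell^{xx}_T$, $v_T = \ell^x_T$. Then, for a vector $p = (p_{x_0},\dots,p_{x_T},p_{u_t},\dots,p_{u_{T-1}})$, the last $(T-t)(n_x+n_u)$ rows of the Newton system $\nabla^2 J\, p = -\nabla J$ (i.e. the block rows corresponding to the variables $x_{t+1},\dots,x_T,u_t,\dots,u_{T-1}$)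 hold if and only if, for all $k=t,\dots,T-1$, \begin{align*} p_{u_k} &= G_k p_{x_k} + g_k,\\ p_{x_{k+1}} &= \left(I_{n_x} - \mu Q_{k+1}V_{k+1}\right)^{-1}\left(f^x_k p_{x_k} + f^u_k p_{u_k} + \mu Q_{k+1} v_{k+1} - w^i_{k+1}\right). \end{align*}
   Context: Setting. Let $T\ge 1$ and $0\le t\le T$ be integers and $\mu>0$. States $x_j\in\mathbb R^{n_x}$, controls $u_j\in\mathbb R^{n_u}$, measurements $y_j\in\mathbb{R}^{n_y}$. The maps $f_j:\mathbb R^{n_x}\times\mathbb R^{n_u}\to\mathbb R^{n_x}$ ($0\le j<T$), $h_j:\mathbb R^{n_x}\to\mathbb R^{n_y}$ ($1\le j\le t$), $\ell_j:\mathbb R^{n_x}\times\mathbb R^{n_u}\to\mathbb R$ ($0\le j<T$), $\ell_T:\mathbb R^{n_x}\to\mathbb R$ are $\mathcal C^2$. The matrices $P$, $Q_j$ ($1\le j\le T$), $R_j$ ($1\le j\le t$) are symmetric positive definite. The past controls $u_0,\dots,u_{t-1}$, the measurements $y_1,\dots,y_t$ and the prior $\hat x_0$ are given and fixed. Define the function of the variables $x_{0:T}=(x_0,\dots,x_T)$ and $u_{t:T-1}=(u_t,\dots,u_{T-1})$ \begin{align*} J(x_{0:T},u_{t:T-1}) &= \sum_{j=0}^{T-1}\ell_j(x_j,u_j)+\ell_T(x_T) - \tfrac1{2\mu}(x_0-\hat x_0)^TP^{-1}(x_0-\hat x_0)\\ &\quad - \tfrac1{2\mu}\sum_{j=1}^t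 (y_j-h_j(x_j))^TR_j^{-1}(y_j-h_j(x_j))\\ &\quad - \tfrac1{2\mu}\sum_{j=0}^{T-1}(x_{j+1}-f_j(x_j,u_j))^TQ_{j+1}^{-1}(x_{j+1}-f_j(x_j,u_j)). \end{align*} Fix a current iterate $(x^i_{0:T},u^i_{t:T-1})$ (with $u^i_k=u_k$ for $k<t$). All derivatives below, and $\nabla J,\nabla^2 J$, are evaluated at this iterate. The Newton step is $p=(p_{x_{0:T}},p_{u_{t:T-1}})$, with $p_{x_k}\in\mathbb R^{n_x}$, $p_{u_k}\in\mathbb R^{n_u}$, satisfying $\nabla^2 J\,p=-\nabla J$, with the variables ordered as $(x_0,\dots,x_T,u_t,\dots,u_{T-1})$. Notation. Superscripts denote derivatives: $f^x_k,f^u_k,h^x_k$ are Jacobian matrices; $\ell^x_k,\ell^u_k$ are gradient column vectors; $\ell^{xx}_k,\ell^{uu}_k,\ell^{xu}_k,\ell^{ux}_k=(\ell^{xu}_k)^T$ are blocks of the Hessian ($\ell_k^{ux}$ has size $n_u\times n_x$). Put $w^i_{k+1}=x^i_{k+1}-f_k(x^i_k,u^i_k)$ and $\gamma^i_k=y_k-h_k(x^i_k)$. For a vector $a$ and a vector-valued function $\phi$, $a^T\phi^{xx}=\sum_m a_m\phi_m^{xx}$ (weighted sum of the Hessians of the components), and similarly for $\phi^{xu},\phi^{uu}$. For $k<T$ define \begin{align*} \bar\ell^{xx}_k&=\ell^{xx}_k+\mu^{-1}{w^i_{k+1}}^TQ_{k+1}^{-1}f^{xx}_k+\mu^{-1}\mathbf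 1_{1\le k\le t}\,{\gamma^i_k}^TR_k^{-1}h^{xx}_k,\\ \bar\ell^{xu}_k&=(\bar\ell^{ux}_k)^T=\ell^{xu}_k+\mu^{-1}{w^i_{k+1}}^TQ_{k+1}^{-1}f^{xu}_k,\\ \bar\ell^{uu}_k&=\ell^{uu}_k+\mu^{-1}{w^i_{k+1}}^TQ_{k+1}^{-1}f^{uu}_k. \end{align*} *)

theory Defs
  imports "HOL-Analysis.Analysis"
begin

definition C2 :: "('a::real_normed_vector \<Rightarrow> 'b::real_normed_vector) \<Rightarrow> bool" where
  "C2 \<phi> \<longleftrightarrow> (\<exists>(\<phi>' :: 'a \<Rightarrow> 'a \<Rightarrow>\<^sub>L 'b) (\<phi>'' :: 'a \<Rightarrow> 'a \<Rightarrow>\<^sub>L 'a \<Rightarrow>\<^sub>L 'b).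
     (\<forall>x. (\<phi> has_derivative blinfun_apply (\<phi>' x)) (at x)) \<and>
     (\<forall>x. (\<phi>' has_derivative blinfun_apply (\<phi>'' x)) (at x)) \<and>
     continuous_on UNIV \<phi>'')"

definition sym_pos_def :: "real^'n^'n \<Rightarrow> bool" where
  "sym_pos_def A \<longleftrightarrow> transpose A = A \<and> (\<forall>v. v \<noteq> 0 \<longrightarrow> 0 < v \<bullet> (A *v v))"

definition grad :: "('a::real_inner \<Rightarrow> real) \<Rightarrow> 'a \<Rightarrow> 'a" where
  "grad \<phi> x = (THE D. GDERIV \<phi> x :> D)"

lemma grad_eq:
  assumes "GDERIV \<phi> x :> D"
  shows "grad \<phi> x = D"
  unfolding grad_def
proof (rule the_equality)
  fix D' assume "GDERIV \<phi> x :> D'"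
  then have "(\<lambda>h. h \<bullet> D') = (\<lambda>h. h \<bullet> D)"
    using assms unfolding gderiv_def by (rule has_derivative_unique)
  then show "D' = D"
    by (metis vector_eq_ldot)
qed (fact assms)

definition hess :: "(real^'n \<Rightarrow> real) \<Rightarrow> real^'n \<Rightarrow> real^'n^'n" where
  "hess \<phi> x = jacobian (grad \<phi>) (at x)"


text \<open>Partial derivatives of functions of a state-control pair \<open>(x, u)\<close>. The blocks have
  sizes \<open>jac_x : m \<times> n\<^sub>x\<close>, \<open>jac_u : m \<times> n\<^sub>u\<close>, \<open>hess_xu : n\<^sub>x \<times> n\<^sub>u\<close>.\<close>

definition jac_x :: "((real^'nx) \<times> (real^'nu) \<Rightarrow> real^'m) \<Rightarrow> (real^'nx) \<times> (real^'nu) \<Rightarrow> real^'nx^'m" where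
  "jac_x \<phi> z = jacobian (\<lambda>x. \<phi> (x, snd z)) (at (fst z))"

definition jac_u :: "((real^'nx) \<times> (real^'nu) \<Rightarrow> real^'m) \<Rightarrow> (real^'nx) \<times> (real^'nu) \<Rightarrow> real^'nu^'m" where
  "jac_u \<phi> z = jacobian (\<lambda>u. \<phi> (fst z, u)) (at (snd z))"

definition grad_x :: "((real^'nx) \<times> (real^'nu) \<Rightarrow> real) \<Rightarrow> (real^'nx) \<times> (real^'nu) \<Rightarrow> real^'nx" where
  "grad_x \<phi> z = grad (\<lambda>x. \<phi> (x, snd z)) (fst z)"

definition grad_u :: "((real^'nx) \<times> (real^'nu) \<Rightarrow> real) \<Rightarrow> (real^'nx) \<times> (real^'nu) \<Rightarrow> real^'nu" where
  "grad_u \<phi> z = grad (\<lambda>u. \<phi> (fst z, u)) (snd z)"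

definition hess_xx :: "((real^'nx) \<times> (real^'nu) \<Rightarrow> real) \<Rightarrow> (real^'nx) \<times> (real^'nu) \<Rightarrow> real^'nx^'nx" where
  "hess_xx \<phi> = jac_x (grad_x \<phi>)"

definition hess_xu :: "((real^'nx) \<times> (real^'nu) \<Rightarrow> real) \<Rightarrow> (real^'nx) \<times> (real^'nu) \<Rightarrow> real^'nu^'nx" where
  "hess_xu \<phi> = jac_u (grad_x \<phi>)"

definition hess_uu :: "((real^'nx) \<times> (real^'nu) \<Rightarrow> real) \<Rightarrow> (real^'nx) \<times> (real^'nu) \<Rightarrow> real^'nu^'nu" where
  "hess_uu \<phi> = jac_u (grad_u \<phi>)"

text \<open>\<open>weighted H a \<phi> z\<close> is the contraction \<open>\<Sum>\<^sub>m a\<^sub>m H(\<phi>\<^sub>m)(z)\<close>, where \<open>H\<close> is one of the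
  Hessian operators above and \<open>\<phi>\<^sub>m\<close> are the components of \<open>\<phi>\<close>.\<close>

definition weighted ::
    "(('z \<Rightarrow> real) \<Rightarrow> 'z \<Rightarrow> real^'c^'r) \<Rightarrow> real^'m \<Rightarrow> ('z \<Rightarrow> real^'m) \<Rightarrow> 'z \<Rightarrow> real^'c^'r" where
  "weighted H a \<phi> z = (\<Sum>m\<in>UNIV. (a $ m) *\<^sub>R H (\<lambda>z'. \<phi> z' $ m) z)"


text \<open>The number of unknowns depends on the horizon, so a stacked vector
  \<open>(x\<^sub>0, \<dots>, x\<^sub>T, u\<^sub>t, \<dots>, u\<^sub>T\<^sub>-\<^sub>1)\<close> is represented by a function on scalar coordinates: \<open>XC k i\<close> is the
  \<open>i\<close>-th component of \<open>x\<^sub>k\<close> and \<open>UC k i\<close> the \<open>i\<close>-th component of \<open>u\<^sub>k\<close>. Only the coordinates in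
  the finite set \<open>variables T t\<close> are variables of the problem.\<close>

datatype ('nx, 'nu) coord = XC nat 'nx | UC nat 'nu

definition stack :: "(nat \<Rightarrow> real^'nx) \<Rightarrow> (nat \<Rightarrow> real^'nu) \<Rightarrow> ('nx, 'nu) coord \<Rightarrow> real" where
  "stack x u c = (case c of XC k i \<Rightarrow> x k $ i | UC k i \<Rightarrow> u k $ i)"

definition xpart :: "(('nx::finite, 'nu) coord \<Rightarrow> real) \<Rightarrow> nat \<Rightarrow> real^'nx" where
  "xpart z k = (\<chi> i. z (XC k i))"

definition upart :: "(('nx, 'nu::finite) coord \<Rightarrow> real) \<Rightarrow> nat \<Rightarrow> real^'nu" where
  "upart z k = (\<chi> i. z (UC k i))"

definition variables :: "nat \<Rightarrow> nat \<Rightarrow> ('nx, 'nu) coord set" where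
  "variables T t = {XC k i | k i. k \<le> T} \<union> {UC k i | k i. t \<le> k \<and> k < T}"

text \<open>The coordinates of \<open>x\<^sub>t\<^sub>+\<^sub>1, \<dots>, x\<^sub>T, u\<^sub>t, \<dots>, u\<^sub>T\<^sub>-\<^sub>1\<close>.\<close>

definition last_rows :: "nat \<Rightarrow> nat \<Rightarrow> ('nx, 'nu) coord set" where
  "last_rows T t = {XC k i | k i. t < k \<and> k \<le> T} \<union> {UC k i | k i. t \<le> k \<and> k < T}"

lemma coord_sets_as_images:
  "variables T t = case_prod XC ` ({..T} \<times> UNIV) \<union> case_prod UC ` ({t..<T} \<times> UNIV)"
  "last_rows T t = case_prod XC ` ({t<..T} \<times> UNIV) \<union> case_prod UC ` ({t..<T} \<times> UNIV)"
  unfolding variables_def last_rows_def by (auto simp: image_iff)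

lemma finite_variables [simp]:
  "finite (variables T t :: ('nx::finite, 'nu::finite) coord set)"
  by (simp add: coord_sets_as_images)

lemma last_rows_subset: "last_rows T t \<subseteq> variables T t"
  by (auto simp: last_rows_def variables_def)

lemma card_coord_image:
  "finite K \<Longrightarrow> card (case_prod XC ` (K \<times> UNIV) :: ('nx::finite, 'nu::finite) coord set) = card K * CARD('nx)"
  "finite K \<Longrightarrow> card (case_prod UC ` (K \<times> UNIV) :: ('nx, 'nu) coord set) = card K * CARD('nu)"
  by (subst card_image; auto simp: inj_on_def card_cartesian_product)+

lemma card_last_rows:
  "card (last_rows T t :: ('nx::finite, 'nu::finite) coord set) = (T - t) * (CARD('nx) + CARD('nu))"
proof -
  let ?A = "case_prod XC ` ({t<..T} \<times> UNIV) :: ('nx, 'nu) coord set"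
  let ?B = "case_prod UC ` ({t..<T} \<times> UNIV) :: ('nx, 'nu) coord set"
  have "card (?A \<union> ?B) = card ?A + card ?B"
    by (rule card_Un_disjoint) auto
  then show ?thesis
    by (simp add: coord_sets_as_images card_coord_image algebra_simps)
qed

definition partial_deriv :: "'i \<Rightarrow> (('i \<Rightarrow> real) \<Rightarrow> real) \<Rightarrow> ('i \<Rightarrow> real) \<Rightarrow> real" where
  "partial_deriv c F z = deriv (\<lambda>s. F (z(c := s))) (z c)"

definition gradient :: "(('i \<Rightarrow> real) \<Rightarrow> real) \<Rightarrow> ('i \<Rightarrow> real) \<Rightarrow> 'i \<Rightarrow> real" where
  "gradient F z c = partial_deriv c F z"

definition hessian :: "(('i \<Rightarrow> real) \<Rightarrow> real) \<Rightarrow> ('i \<Rightarrow> real) \<Rightarrow> 'i \<Rightarrow> 'i \<Rightarrow> real" where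
  "hessian F z c d = partial_deriv d (partial_deriv c F) z"


definition J ::
  "nat \<Rightarrow> nat \<Rightarrow> real \<Rightarrow> (nat \<Rightarrow> (real^'nx) \<times> (real^'nu) \<Rightarrow> real^'nx) \<Rightarrow> (nat \<Rightarrow> real^'nx \<Rightarrow> real^'ny) \<Rightarrow>
   (nat \<Rightarrow> (real^'nx) \<times> (real^'nu) \<Rightarrow> real) \<Rightarrow> (real^'nx \<Rightarrow> real) \<Rightarrow>
   real^'nx^'nx \<Rightarrow> (nat \<Rightarrow> real^'nx^'nx) \<Rightarrow> (nat \<Rightarrow> real^'ny^'ny) \<Rightarrow>
   (nat \<Rightarrow> real^'nu) \<Rightarrow> (nat \<Rightarrow> real^'ny) \<Rightarrow> real^'nx \<Rightarrow> (('nx, 'nu) coord \<Rightarrow> real) \<Rightarrow> real" where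
  "J T t \<mu> f h l lT P Q R up y xhat z =
    (let x = xpart z; u = (\<lambda>j. if j < t then up j else upart z j) in
       (\<Sum>j<T. l j (x j, u j)) + lT (x T)
       - 1 / (2 * \<mu>) * ((x 0 - xhat) \<bullet> (matrix_inv P *v (x 0 - xhat)))
       - 1 / (2 * \<mu>) * (\<Sum>j=1..t. (y j - h j (x j)) \<bullet> (matrix_inv (R j) *v (y j - h j (x j))))
       - 1 / (2 * \<mu>) * (\<Sum>j<T. (x (j+1) - f j (x j, u j)) \<bullet>
                                (matrix_inv (Q (j+1)) *v (x (j+1) - f j (x j, u j)))))"

lemma J_cong:
  assumes "\<And>c. c \<in> variables T t \<Longrightarrow> z c = z' c" and "t \<le> T"
  shows "J T t \<mu> f h l lT P Q R up y xhat z = J T t \<mu> f h l lT P Q R up y xhat z'"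
proof -
  have "xpart z k = xpart z' k" if "k \<le> T" for k
    using assms(1) that by (auto simp: xpart_def variables_def)
  moreover have "upart z k = upart z' k" if "t \<le> k" "k < T" for k
    using assms(1) that by (auto simp: upart_def variables_def)
  ultimately show ?thesis
    using assms(2) by (simp add: J_def Let_def not_less cong: if_cong)
qed

end

theory Submission
  imports Defs
begin

text \<open>
  Write \<open>\<lambda>\<^sub>k = \<mu>\<^sup>-\<^sup>1 Q\<^sub>k\<^sup>-\<^sup>1 (w\<^sub>k + p\<^sub>x\<^sub>k - f\<^sup>x p\<^sub>x\<^sub>k\<^sub>-\<^sub>1 - f\<^sup>u p\<^sub>u\<^sub>k\<^sub>-\<^sub>1)\<close> for the linearised multiplier of the \<open>k\<close>-th
  transition. In these terms the row of the Newton system at \<open>u\<^sub>k\<close> reads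
  \<open>\<ell>\<^sup>u + L\<^sup>u\<^sup>x p\<^sub>x + L\<^sup>u\<^sup>u p\<^sub>u + (f\<^sup>u)\<^sup>T \<lambda>\<^sub>k\<^sub>+\<^sub>1 = 0\<close>, the row at \<open>x\<^sub>k\<close> with \<open>t < k < T\<close> reads
  \<open>\<lambda>\<^sub>k = \<ell>\<^sup>x + L\<^sup>x\<^sup>x p\<^sub>x + L\<^sup>x\<^sup>u p\<^sub>u + (f\<^sup>x)\<^sup>T \<lambda>\<^sub>k\<^sub>+\<^sub>1\<close>, and the row at \<open>x\<^sub>T\<close> gives \<open>\<lambda>\<^sub>T = V\<^sub>T p + v\<^sub>T\<close>.
  Descending from \<open>T\<close>, the relation \<open>\<lambda>\<^sub>k\<^sub>+\<^sub>1 = V\<^sub>k\<^sub>+\<^sub>1 p + v\<^sub>k\<^sub>+\<^sub>1\<close> is equivalent to the update of \<open>p\<^sub>x\<close>, the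
  row at \<open>u\<^sub>k\<close> is then the feedback law, and eliminating both turns the row at \<open>x\<^sub>k\<close> into the same
  relation at stage \<open>k\<close>. Symmetry of \<open>V\<close>, hence the equality of mixed second derivatives, enters when
  the coefficient of \<open>p\<^sub>u\<close> in the state row is identified with the transpose of \<open>Q\<^sub>u\<^sub>x\<close>.
\<close>

subsection \<open>Matrix algebra of one stage\<close>

lemma matrix_inv_left_right:
  fixes A :: "real^'n^'n"
  assumes "invertible A"
  shows "matrix_inv A ** A = mat 1" "A ** matrix_inv A = mat 1"
  using someI_ex[OF assms[unfolded invertible_def]] by (auto simp: matrix_inv_def)

lemma matrix_inv_mult_eq_iff:
  fixes A :: "real^'n^'n"
  assumes "invertible A"
  shows "x = matrix_inv A *v b \<longleftrightarrow> A *v x = b"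
  using matrix_inv_left_right[OF assms] by (metis matrix_vector_mul_assoc matrix_vector_mul_lid)

lemma matrix_vector_mult_uminus [simp]: "A *v (- x) = - (A *v x :: real^'m)"
  by (simp add: vec_eq_iff matrix_vector_mult_def sum_negf)

lemma uminus_matrix_vector_mult [simp]: "(- A) *v x = - (A *v x :: real^'m)"
  by (simp add: vec_eq_iff matrix_vector_mult_def sum_negf)

lemma transpose_add: "transpose (A + B) = transpose A + transpose B"
  by (simp add: transpose_def vec_eq_iff)

lemma transpose_diff: "transpose (A - B) = transpose A - transpose B"
  by (simp add: transpose_def vec_eq_iff)

lemma transpose_uminus: "transpose (- A) = - transpose (A :: real^'n^'m)"
  by (simp add: transpose_def vec_eq_iff)

lemma matrix_inv_transpose:
  fixes A :: "real^'n^'n"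
  assumes "invertible A"
  shows "matrix_inv (transpose A) = transpose (matrix_inv A)"
proof -
  have "transpose (matrix_inv A) *v x = matrix_inv (transpose A) *v x" for x
    using matrix_inv_left_right[OF assms] transpose_invertible[OF assms]
    by (metis matrix_inv_mult_eq_iff matrix_transpose_mul matrix_vector_mul_assoc matrix_vector_mul_lid
        transpose_mat)
  then show ?thesis
    by (metis matrix_eq)
qed

lemma symmetric_matrixI:
  fixes A :: "real^'n^'n"
  assumes "\<And>a b. a \<bullet> (A *v b) = b \<bullet> (A *v a)"
  shows "transpose A = A"
proof -
  have "(transpose A *v a) \<bullet> b = (A *v a) \<bullet> b" for a b
    by (metis assms dot_lmul_matrix inner_commute transpose_matrix_vector)
  then show ?thesis
    by (metis matrix_eq vector_eq_rdot)
qed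

lemma inner_symmetric_matrix:
  fixes A :: "real^'n^'n"
  assumes "transpose A = A"
  shows "a \<bullet> (A *v b) = b \<bullet> (A *v a)"
  by (metis assms dot_lmul_matrix inner_commute transpose_matrix_vector)

lemma sym_pos_def_invertible:
  assumes "sym_pos_def A"
  shows "invertible A"
proof -
  have "\<forall>x. A *v x = 0 \<longrightarrow> x = 0"
    using assms unfolding sym_pos_def_def by (metis inner_zero_right less_irrefl)
  then show ?thesis
    by (metis invertible_left_inverse matrix_left_invertible_ker)
qed

text \<open>The matrix inverted in the state update is the transpose of \<Gamma>, so the
  invertibility assumed for \<Gamma> carries over to it.\<close>

lemma transpose_pencil:
  fixes V Q \<Gamma> :: "real^'n^'n"
  assumes V: "transpose V = V" and Q: "transpose Q = Q"
    and \<Gamma>: "\<Gamma> = mat 1 - \<mu> *\<^sub>R (V ** Q)"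
  shows "transpose \<Gamma> = mat 1 - \<mu> *\<^sub>R (Q ** V)"
  by (simp add: assms transpose_diff transpose_scalar matrix_transpose_mul)

text \<open>Both \<open>\<Gamma> ** V\<close> and \<open>V ** transpose \<Gamma>\<close> equal V -
  \<mu> V Q V. Multiplying by the inverse of \<Gamma> on the left and its transpose on the right
  gives the claim.\<close>

lemma transpose_gain:
  fixes V Q \<Gamma> :: "real^'n^'n"
  assumes V: "transpose V = V" and Q: "transpose Q = Q"
    and \<Gamma>: "\<Gamma> = mat 1 - \<mu> *\<^sub>R (V ** Q)" and inv: "invertible \<Gamma>"
  shows "transpose (matrix_inv \<Gamma> ** V) = matrix_inv \<Gamma> ** V"
proof -
  let ?N = "matrix_inv \<Gamma>"
  have N: "transpose ?N = matrix_inv (transpose \<Gamma>)"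
    using inv by (simp add: matrix_inv_transpose)
  have "\<Gamma> ** V = V ** transpose \<Gamma>"
    unfolding transpose_pencil[OF V Q \<Gamma>] unfolding \<Gamma>
    by (simp add: matrix_eq matrix_vector_mul_assoc[symmetric] algebra_simps scaleR_matrix_vector_assoc[symmetric])
  then have "?N ** (\<Gamma> ** V) ** transpose ?N = ?N ** (V ** transpose \<Gamma>) ** transpose ?N"
    by simp
  moreover have "?N ** (\<Gamma> ** V) = V"
    by (simp add: matrix_mul_assoc matrix_inv_left_right[OF inv])
  moreover have "?N ** (V ** transpose \<Gamma>) ** transpose ?N = ?N ** V"
    unfolding N using matrix_inv_left_right[OF transpose_invertible[OF inv]]
    by (metis matrix_mul_assoc matrix_mul_rid)
  ultimately show ?thesis
    by (simp add: matrix_transpose_mul V)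
qed

text \<open>Multiply by \<mu> and by \<open>Q\<close>, then collect the terms in \<open>p\<close>.
  Every step is reversible because \<open>Q\<close>, \<mu> and the transpose of \<Gamma> are
  invertible.\<close>

lemma multiplier_affine_iff:
  fixes V Q \<Gamma> :: "real^'n^'n"
  assumes V: "transpose V = V" and Q: "transpose Q = Q" "invertible Q"
    and \<Gamma>: "\<Gamma> = mat 1 - \<mu> *\<^sub>R (V ** Q)" and inv: "invertible \<Gamma>" and "\<mu> \<noteq> 0"
    and lam: "lam = (1/\<mu>) *\<^sub>R (matrix_inv Q *v (w + (p - d)))"
  shows "lam = V *v p + v \<longleftrightarrow> p = matrix_inv (mat 1 - \<mu> *\<^sub>R (Q ** V)) *v (d + \<mu> *\<^sub>R (Q *v v) - w)"
proof -
  note tr = transpose_pencil[OF V Q(1) \<Gamma>]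
  have "lam = V *v p + v \<longleftrightarrow> \<mu> *\<^sub>R (V *v p + v) = matrix_inv Q *v (w + (p - d))"
    unfolding lam using \<open>\<mu> \<noteq> 0\<close> by (auto simp: vector_fraction_eq_iff field_simps)
  also have "\<dots> \<longleftrightarrow> Q *v (\<mu> *\<^sub>R (V *v p + v)) = w + (p - d)"
    by (rule matrix_inv_mult_eq_iff[OF Q(2)])
  also have "\<dots> \<longleftrightarrow> (mat 1 - \<mu> *\<^sub>R (Q ** V)) *v p = d + \<mu> *\<^sub>R (Q *v v) - w"
    by (auto simp: matrix_vector_mul_assoc[symmetric] algebra_simps scaleR_matrix_vector_assoc[symmetric])
  also have "\<dots> \<longleftrightarrow> p = matrix_inv (mat 1 - \<mu> *\<^sub>R (Q ** V)) *v (d + \<mu> *\<^sub>R (Q *v v) - w)"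
    using matrix_inv_mult_eq_iff[OF transpose_invertible[OF inv]] unfolding tr by blast
  finally show ?thesis .
qed

text \<open>Eliminates the next state: the definition of \<open>lam\<close> gives p = d - w + \<mu>
  Q lam, and substitution into the affine relation leaves \<Gamma> lam on the left. The multiplier
  is then a function of the current stage alone, through \<open>d\<close>.\<close>

lemma multiplier_eq:
  fixes V Q \<Gamma> :: "real^'n^'n"
  assumes Q: "invertible Q"
    and \<Gamma>: "\<Gamma> = mat 1 - \<mu> *\<^sub>R (V ** Q)" and inv: "invertible \<Gamma>" and "\<mu> \<noteq> 0"
    and lam: "lam = (1/\<mu>) *\<^sub>R (matrix_inv Q *v (w + (p - d)))"
    and eq: "lam = V *v p + v"
  shows "lam = matrix_inv \<Gamma> *v (V *v (d - w) + v)"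
proof -
  have "\<mu> *\<^sub>R lam = matrix_inv Q *v (w + (p - d))"
    unfolding lam using \<open>\<mu> \<noteq> 0\<close> by simp
  then have "Q *v (\<mu> *\<^sub>R lam) = w + (p - d)"
    using matrix_inv_mult_eq_iff[OF Q] by blast
  then have "p = d - w + \<mu> *\<^sub>R (Q *v lam)"
    by (simp add: algebra_simps)
  then have "lam = V *v (d - w + \<mu> *\<^sub>R (Q *v lam)) + v"
    using eq by simp
  then have "\<Gamma> *v lam = V *v (d - w) + v"
    unfolding \<Gamma> by (simp add: matrix_vector_mul_assoc[symmetric] algebra_simps scaleR_matrix_vector_assoc[symmetric])
  then show ?thesis
    using matrix_inv_mult_eq_iff[OF inv] by blast
qed

text \<open>With \<open>lam\<close> expressed through \<open>p\<close> and \<open>q\<close>, the row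
  collapses to Quu q + Qux p + Qu = 0, which is solved for \<open>q\<close>.\<close>

lemma control_row_iff:
  fixes V N A :: "real^'n^'n" and B :: "real^'m^'n" and Bt :: "real^'n^'m"
  assumes Quu: "Quu = Luu + Bt ** N ** V ** B" and Qux: "Qux = Lux + Bt ** N ** V ** A"
    and Qu: "Qu = lu + (Bt ** N) *v (v - V *v w)"
    and lam: "lam = N *v (V *v (A *v p + B *v q - w) + v)" and inv: "invertible Quu"
  shows "lu + Lux *v p + Luu *v q + Bt *v lam = 0 \<longleftrightarrow>
    q = (- (matrix_inv Quu ** Qux)) *v p + - (matrix_inv Quu *v Qu)"
proof -
  have "lu + Lux *v p + Luu *v q + Bt *v lam = Quu *v q - - (Qux *v p + Qu)"
    unfolding Quu Qux Qu lam
    by (simp add: matrix_vector_mul_assoc[symmetric] algebra_simps)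
  also have "\<dots> = 0 \<longleftrightarrow> Quu *v q = - (Qux *v p + Qu)"
    by (rule right_minus_eq)
  also have "\<dots> \<longleftrightarrow> q = matrix_inv Quu *v (- (Qux *v p + Qu))"
    using matrix_inv_mult_eq_iff[OF inv] by blast
  finally show ?thesis
    by (simp add: matrix_vector_mul_assoc[symmetric] algebra_simps)
qed

text \<open>After substituting \<open>lam\<close>, the coefficient of \<open>q\<close> is exactly
  the transpose of \<open>Qux\<close>; inserting the feedback law then produces the last terms of
  \<open>V'\<close> and \<open>v'\<close>.\<close>

lemma state_row_eq:
  fixes V N A :: "real^'n^'n" and B :: "real^'m^'n"
  assumes QuxT: "transpose Qux = Lxu + At ** N ** V ** B"
    and V': "V' = Lxx + At ** N ** V ** A + transpose Qux ** G"
    and v': "v' = lx + (At ** N) *v (v - V *v w) + transpose Qux *v g"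
    and lam: "lam = N *v (V *v (A *v p + B *v q - w) + v)" and q: "q = G *v p + g"
  shows "lx + Lxx *v p + Lxu *v q + At *v lam = V' *v p + v'"
  unfolding V' v' QuxT lam q
  by (simp add: matrix_vector_mul_assoc[symmetric] algebra_simps del: transpose_matrix_vector)

text \<open>The middle factor \<open>matrix_inv \<Gamma> ** V\<close> is symmetric, so transposition
  only exchanges the outer factors. Equal factors give symmetric blocks, different ones relate the
  two mixed blocks.\<close>

lemma transpose_gain_congruence:
  fixes V Q \<Gamma> :: "real^'n^'n" and X :: "real^'a^'n" and Y :: "real^'b^'n"
  assumes "transpose V = V" and "transpose Q = Q"
    and "\<Gamma> = mat 1 - \<mu> *\<^sub>R (V ** Q)" and "invertible \<Gamma>"
  shows "transpose (transpose X ** matrix_inv \<Gamma> ** V ** Y) = transpose Y ** matrix_inv \<Gamma> ** V ** X"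
  using transpose_gain[OF assms] by (metis matrix_mul_assoc matrix_transpose_mul transpose_transpose)

text \<open>Each summand is symmetric: the second is a congruence of the symmetric gain, the third
  is minus a congruence of the inverse of \<open>Quu\<close>, which inherits symmetry from
  \<open>Quu\<close>.\<close>

lemma riccati_symmetric:
  fixes V Q \<Gamma> A :: "real^'n^'n" and B :: "real^'m^'n"
  assumes gain: "transpose V = V" "transpose Q = Q" "\<Gamma> = mat 1 - \<mu> *\<^sub>R (V ** Q)" "invertible \<Gamma>"
    and Quu: "Quu = Luu + transpose B ** matrix_inv \<Gamma> ** V ** B" "invertible Quu"
    and L: "transpose Luu = Luu" "transpose Lxx = Lxx"
  shows "transpose (Lxx + transpose A ** matrix_inv \<Gamma> ** V ** A + transpose X ** - (matrix_inv Quu ** X)) =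
    Lxx + transpose A ** matrix_inv \<Gamma> ** V ** A + transpose X ** - (matrix_inv Quu ** X)"
proof -
  have "transpose Quu = Quu"
    unfolding Quu by (simp add: transpose_add transpose_gain_congruence[OF gain] L)
  then have "transpose (matrix_inv Quu) = matrix_inv Quu"
    using matrix_inv_transpose[OF Quu(2)] by simp
  then have "transpose (transpose X ** - (matrix_inv Quu ** X)) = transpose X ** - (matrix_inv Quu ** X)"
    by (simp add: matrix_eq matrix_transpose_mul transpose_uminus matrix_vector_mul_assoc[symmetric] del: transpose_matrix_vector)
  then show ?thesis
    by (simp only: transpose_add transpose_gain_congruence[OF gain] L)
qed

subsection \<open>Second derivatives\<close>

text \<open>Two mean value steps: first along \<open>a\<close> for the difference of \<phi> between
  the lines shifted and not shifted by \<open>h *\<^sub>R b\<close>, then along \<open>b\<close> for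
  \<open>\<phi>1\<close> applied to \<open>a\<close>.\<close>

lemma double_difference_mean_value:
  fixes \<phi> :: "'a::real_normed_vector \<Rightarrow> real"
  assumes d1: "\<And>x. (\<phi> has_derivative \<phi>1 x) (at x)"
    and d2: "\<And>x a. ((\<lambda>x. \<phi>1 x a) has_derivative (\<lambda>b. \<phi>2 x b a)) (at x)"
    and "0 < h"
  obtains \<xi> \<eta> where "0 < \<xi>" "\<xi> < h" "0 < \<eta>" "\<eta> < h"
    "\<phi> (z + h *\<^sub>R a + h *\<^sub>R b) - \<phi> (z + h *\<^sub>R a) - \<phi> (z + h *\<^sub>R b) + \<phi> z = h * h * \<phi>2 (z + \<xi> *\<^sub>R a + \<eta> *\<^sub>R b) b a"
proof -
  have lin1: "\<phi>1 x (r *\<^sub>R c) = r * \<phi>1 x c" for x r c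
    using has_derivative_linear[OF d1] by (simp add: linear_scale)
  have lin2: "\<phi>2 x (r *\<^sub>R c) e = r * \<phi>2 x c e" for x r c e
    using linear_scale[OF has_derivative_linear[OF d2[of e x]], of r c] by simp
  have D1: "((\<lambda>s. \<phi> (x + s *\<^sub>R c)) has_real_derivative \<phi>1 (x + s *\<^sub>R c) c) (at s)" for x c s
    unfolding has_field_derivative_def
    by (rule has_derivative_eq_rhs, rule has_derivative_compose[OF _ d1, where f="\<lambda>s. x + s *\<^sub>R c"])
      (auto intro!: derivative_eq_intros simp: lin1 mult.commute)
  have D2: "((\<lambda>s. \<phi>1 (x + s *\<^sub>R c) e) has_real_derivative \<phi>2 (x + s *\<^sub>R c) c e) (at s)" for x c s e
    unfolding has_field_derivative_def
    by (rule has_derivative_eq_rhs, rule has_derivative_compose[OF _ d2, where f="\<lambda>s. x + s *\<^sub>R c"])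
      (auto intro!: derivative_eq_intros simp: lin2 mult.commute)
  let ?g = "\<lambda>s. \<phi> (z + h *\<^sub>R b + s *\<^sub>R a) - \<phi> (z + s *\<^sub>R a)"
  have "(?g has_real_derivative \<phi>1 (z + h *\<^sub>R b + s *\<^sub>R a) a - \<phi>1 (z + s *\<^sub>R a) a) (at s)" for s
    by (intro DERIV_diff D1)
  from MVT2[OF \<open>0 < h\<close> this] obtain \<xi> where \<xi>: "0 < \<xi>" "\<xi> < h"
    "?g h - ?g 0 = (h - 0) * (\<phi>1 (z + h *\<^sub>R b + \<xi> *\<^sub>R a) a - \<phi>1 (z + \<xi> *\<^sub>R a) a)"
    by blast
  from MVT2[OF \<open>0 < h\<close> D2[of "z + \<xi> *\<^sub>R a" b a]] obtain \<eta> where \<eta>: "0 < \<eta>" "\<eta> < h"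
    "\<phi>1 ((z + \<xi> *\<^sub>R a) + h *\<^sub>R b) a - \<phi>1 ((z + \<xi> *\<^sub>R a) + 0 *\<^sub>R b) a = (h - 0) * \<phi>2 ((z + \<xi> *\<^sub>R a) + \<eta> *\<^sub>R b) b a"
    by blast
  show ?thesis
    using \<xi> \<eta> by (intro that[of \<xi> \<eta>]) (auto simp: algebra_simps)
qed

lemma second_derivative_symmetric_real:
  fixes \<phi> :: "'a::real_normed_vector \<Rightarrow> real"
  assumes d1: "\<And>x. (\<phi> has_derivative \<phi>1 x) (at x)"
    and d2: "\<And>x a. ((\<lambda>x. \<phi>1 x a) has_derivative (\<lambda>b. \<phi>2 x b a)) (at x)"
    and cont: "\<And>a b. isCont (\<lambda>x. \<phi>2 x b a) z"
  shows "\<phi>2 z b a = \<phi>2 z a b"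
proof -
  \<comment> \<open>The second difference quotient is symmetric in \<open>a\<close> and \<open>b\<close> and tends to \<open>\<phi>2 z b a\<close>.\<close>
  define \<Delta> where "\<Delta> h a b = (\<phi> (z + h *\<^sub>R a + h *\<^sub>R b) - \<phi> (z + h *\<^sub>R a) - \<phi> (z + h *\<^sub>R b) + \<phi> z) / (h * h)"
    for h a b
  have lim: "((\<lambda>h. \<Delta> h a b) \<longlongrightarrow> \<phi>2 z b a) (at_right 0)" for a b
  proof -
    \<comment> \<open>The premise \<open>0 < h\<close> sits under the quantifiers so that choice
      yields intermediate points as total functions of \<open>h\<close>.\<close>
    have "\<exists>\<xi> \<eta>. 0 < h \<longrightarrow> 0 < \<xi> \<and> \<xi> < h \<and> 0 < \<eta> \<and> \<eta> < h \<and> \<Delta> h a b = \<phi>2 (z + \<xi> *\<^sub>R a + \<eta> *\<^sub>R b) b a" for h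
    proof (cases "0 < h")
      case True
      from double_difference_mean_value[OF d1 d2 this, of z a b] show ?thesis
        unfolding \<Delta>_def using True by (metis nonzero_mult_div_cancel_left mult_eq_0_iff less_irrefl)
    qed simp
    then obtain \<xi> \<eta> where *: "\<And>h. 0 < h \<Longrightarrow> 0 < \<xi> h \<and> \<xi> h < h \<and> 0 < \<eta> h \<and> \<eta> h < h \<and>
        \<Delta> h a b = \<phi>2 (z + \<xi> h *\<^sub>R a + \<eta> h *\<^sub>R b) b a"
      by metis
    have small: "(\<zeta> \<longlongrightarrow> 0) (at_right 0)" if "\<And>h. 0 < h \<Longrightarrow> 0 < \<zeta> h \<and> \<zeta> h < h" for \<zeta> :: "real \<Rightarrow> real"
      by (rule tendsto_sandwich[of "\<lambda>_. 0" _ _ "\<lambda>h. h"])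
        (use that in \<open>auto simp: eventually_at_filter less_imp_le\<close>)
    have "((\<lambda>h. z + \<xi> h *\<^sub>R a + \<eta> h *\<^sub>R b) \<longlongrightarrow> z + 0 *\<^sub>R a + 0 *\<^sub>R b) (at_right 0)"
      using * by (intro tendsto_intros small) auto
    then have "((\<lambda>h. \<phi>2 (z + \<xi> h *\<^sub>R a + \<eta> h *\<^sub>R b) b a) \<longlongrightarrow> \<phi>2 z b a) (at_right 0)"
      by (intro isCont_tendsto_compose[OF cont]) simp
    then show ?thesis
      by (rule Lim_transform_eventually) (use * in \<open>auto simp: eventually_at_filter\<close>)
  qed
  have "\<Delta> h a b = \<Delta> h b a" for h
    by (simp add: \<Delta>_def algebra_simps)
  then show ?thesis
    using lim[of a b] lim[of b a] tendsto_unique[of "at_right (0::real)"] by auto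
qed

lemma has_vector_derivative_compose_derivative:
  assumes "(\<phi> has_derivative D) (at (Z s))" and "(Z has_vector_derivative e) (at s)"
  shows "((\<lambda>s. \<phi> (Z s)) has_vector_derivative D e) (at s)"
  using has_derivative_compose[OF assms(2)[unfolded has_vector_derivative_def] assms(1)]
    linear_scale[OF has_derivative_linear[OF assms(1)]]
  by (simp add: has_vector_derivative_def)

text \<open>Derivatives as plain curried maps, free of the bounded-linear type. In
  \<open>\<phi>2 z b a\<close> the direction \<open>a\<close> belongs to the first differentiation
  and \<open>b\<close> to the second; linearity in \<open>a\<close> comes from symmetry.\<close>

locale smooth_map =
  fixes \<phi> :: "'a::real_normed_vector \<Rightarrow> 'b::real_inner" and \<phi>1 :: "'a \<Rightarrow> 'a \<Rightarrow> 'b" and \<phi>2 :: "'a \<Rightarrow> 'a \<Rightarrow> 'a \<Rightarrow> 'b"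
  assumes first: "\<And>z. (\<phi> has_derivative \<phi>1 z) (at z)"
    and second: "\<And>z a. ((\<lambda>z. \<phi>1 z a) has_derivative (\<lambda>b. \<phi>2 z b a)) (at z)"
    and symmetric: "\<And>z a b. \<phi>2 z b a = \<phi>2 z a b"
begin

lemma linear1: "linear (\<phi>1 z)"
  by (rule has_derivative_linear[OF first])

lemma linear2_left: "linear (\<lambda>b. \<phi>2 z b a)"
  by (rule has_derivative_linear[OF second])

lemma linear2_right: "linear (\<phi>2 z b)"
proof -
  have "\<phi>2 z b = (\<lambda>a. \<phi>2 z a b)"
    by (simp add: fun_eq_iff symmetric[of z b])
  then show ?thesis
    by (simp add: linear2_left)
qed

lemmas linear_simps = linear_add[OF linear1] linear_scale[OF linear1]
  linear_add[OF linear2_left] linear_scale[OF linear2_left] linear_add[OF linear2_right] linear_scale[OF linear2_right]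

lemma along_curve:
  assumes "(Z has_vector_derivative e) (at s)"
  shows "((\<lambda>s. \<phi> (Z s)) has_vector_derivative \<phi>1 (Z s) e) (at s)"
    and "((\<lambda>s. \<phi>1 (Z s) a) has_vector_derivative \<phi>2 (Z s) e a) (at s)"
  using has_vector_derivative_compose_derivative[OF first assms]
    has_vector_derivative_compose_derivative[OF second assms] .

end

text \<open>Symmetry of the vector-valued second derivative is reduced to the real case by pairing
  with an arbitrary vector \<open>e\<close>.\<close>

lemma C2_smooth_map:
  fixes \<phi> :: "'a::real_normed_vector \<Rightarrow> 'b::real_inner"
  assumes "C2 \<phi>"
  shows "\<exists>\<phi>1 \<phi>2. smooth_map \<phi> \<phi>1 \<phi>2"
proof -
  obtain \<phi>' :: "'a \<Rightarrow> 'a \<Rightarrow>\<^sub>L 'b" and \<phi>'' :: "'a \<Rightarrow> 'a \<Rightarrow>\<^sub>L 'a \<Rightarrow>\<^sub>L 'b"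
    where d1: "\<And>x. (\<phi> has_derivative \<phi>' x) (at x)"
      and d2: "\<And>x. (\<phi>' has_derivative \<phi>'' x) (at x)"
      and cont: "continuous_on UNIV \<phi>''"
    using assms unfolding C2_def by blast
  have d2a: "((\<lambda>x. \<phi>' x a) has_derivative (\<lambda>b. \<phi>'' x b a)) (at x)" for x a
    by (rule bounded_linear.has_derivative[OF blinfun.bounded_linear_left d2])
  have "\<phi>'' z b a \<bullet> e = \<phi>'' z a b \<bullet> e" for z a b e
  proof (rule second_derivative_symmetric_real[where \<phi>="\<lambda>x. \<phi> x \<bullet> e" and ?\<phi>1.0="\<lambda>x a. \<phi>' x a \<bullet> e"
        and ?\<phi>2.0="\<lambda>x b a. \<phi>'' x b a \<bullet> e"])
    have "isCont \<phi>'' z"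
      using cont by (simp add: continuous_on_eq_continuous_at)
    then show "isCont (\<lambda>x. \<phi>'' x b a \<bullet> e) z" for a b
      by (intro continuous_intros)
  qed (intro has_derivative_inner_left d1 d2a)+
  then have "\<phi>'' z b a = \<phi>'' z a b" for z a b
    by (metis vector_eq_rdot)
  with d1 d2a have "smooth_map \<phi> (\<lambda>x. \<phi>' x) (\<lambda>x b. \<phi>'' x b)"
    by (rule smooth_map.intro)
  then show ?thesis
    by blast
qed

section \<open>Gradients and Hessian blocks as linear and bilinear forms\<close>

lemma linear_inner_chi_axis:
  fixes D :: "real^'n \<Rightarrow> real"
  assumes "linear D"
  shows "a \<bullet> (\<chi> i. D (axis i 1)) = D a"
proof -
  have "D a = D (\<Sum>i\<in>UNIV. a $ i *\<^sub>R axis i 1)"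
    by (simp add: basis_expansion[of a, unfolded scalar_mult_eq_scaleR])
  also have "\<dots> = (\<Sum>i\<in>UNIV. a $ i * D (axis i 1))"
    using assms by (simp add: linear_sum linear_scale o_def)
  finally show ?thesis
    by (simp add: inner_vec_def)
qed

lemma grad_has_derivative:
  fixes \<psi> :: "real^'n \<Rightarrow> real"
  assumes "(\<psi> has_derivative D) (at x)"
  shows "a \<bullet> grad \<psi> x = D a"
proof -
  have "GDERIV \<psi> x :> (\<chi> i. D (axis i 1))"
    using assms linear_inner_chi_axis[OF has_derivative_linear[OF assms]] by (simp add: gderiv_def)
  then show ?thesis
    using linear_inner_chi_axis[OF has_derivative_linear[OF assms]] by (simp add: grad_eq)
qed

lemma grad_component:
  fixes \<psi> :: "real^'n \<Rightarrow> real"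
  assumes "(\<psi> has_derivative D) (at x)"
  shows "grad \<psi> x $ i = D (axis i 1)"
  using grad_has_derivative[OF assms, of "axis i 1"] by (simp add: inner_axis')

lemma jacobian_has_derivative:
  fixes \<phi> :: "real^'n \<Rightarrow> real^'m"
  assumes "(\<phi> has_derivative D) (at x)"
  shows "jacobian \<phi> (at x) *v b = D b"
proof -
  have "(\<phi> has_derivative (\<lambda>h. jacobian \<phi> (at x) *v h)) (at x)"
    using assms by (metis differentiableI jacobian_works)
  from has_derivative_unique[OF this assms] show ?thesis
    by metis
qed

lemma has_derivative_chi:
  fixes D :: "'a::real_normed_vector \<Rightarrow> 'n::finite \<Rightarrow> real"
  assumes "\<And>i. ((\<lambda>x. \<phi> x i) has_derivative (\<lambda>b. D b i)) (at x)"
  shows "((\<lambda>x. \<chi> i. \<phi> x i) has_derivative (\<lambda>b. \<chi> i. D b i)) (at x)"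
  using assms by (subst has_derivative_componentwise_within) (auto simp: Basis_vec_def inner_axis)

text \<open>The gradient is known at every point, as the vector of \<open>\<psi>1\<close> on unit
  vectors, so it can be differentiated once more componentwise.\<close>

lemma inner_hess:
  fixes \<psi> :: "real^'n \<Rightarrow> real"
  assumes "smooth_map \<psi> \<psi>1 \<psi>2"
  shows "a \<bullet> (hess \<psi> x *v b) = \<psi>2 x b a"
proof -
  interpret smooth_map \<psi> \<psi>1 \<psi>2
    by (rule assms)
  have "grad \<psi> = (\<lambda>x. \<chi> i. \<psi>1 x (axis i 1))"
    by (simp add: fun_eq_iff vec_eq_iff grad_component[OF first])
  then have "(grad \<psi> has_derivative (\<lambda>b. \<chi> i. \<psi>2 x b (axis i 1))) (at x)"
    by (auto intro: has_derivative_chi second)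
  then have "hess \<psi> x *v b = (\<chi> i. \<psi>2 x b (axis i 1))"
    by (simp add: hess_def jacobian_has_derivative)
  then show ?thesis
    using linear_inner_chi_axis[OF linear2_right] by simp
qed

context
  fixes \<phi> :: "(real^'nx) \<times> (real^'nu) \<Rightarrow> 'b::real_normed_vector" and \<phi>1
  assumes d1: "\<And>z. (\<phi> has_derivative \<phi>1 z) (at z)"
begin

lemma has_derivative_fst_part: "((\<lambda>x. \<phi> (x, u)) has_derivative (\<lambda>a. \<phi>1 (x, u) (a, 0))) (at x)"
  by (rule has_derivative_compose[OF _ d1, where f="\<lambda>x. (x, u)"]) (auto intro!: derivative_eq_intros)

lemma has_derivative_snd_part: "((\<lambda>u. \<phi> (x, u)) has_derivative (\<lambda>a. \<phi>1 (x, u) (0, a))) (at u)"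
  by (rule has_derivative_compose[OF _ d1, where f="\<lambda>u. (x, u)"]) (auto intro!: derivative_eq_intros)

end

lemma jac_x_mult:
  assumes "\<And>z. (\<phi> has_derivative \<phi>1 z) (at z)"
  shows "jac_x \<phi> z *v b = \<phi>1 z (b, 0)"
  using jacobian_has_derivative[OF has_derivative_fst_part[OF assms]] by (simp add: jac_x_def)

lemma jac_u_mult:
  assumes "\<And>z. (\<phi> has_derivative \<phi>1 z) (at z)"
  shows "jac_u \<phi> z *v b = \<phi>1 z (0, b)"
  using jacobian_has_derivative[OF has_derivative_snd_part[OF assms]] by (simp add: jac_u_def)

context
  fixes \<phi> :: "(real^'nx) \<times> (real^'nu) \<Rightarrow> real" and \<phi>1 and \<phi>2
  assumes smooth: "smooth_map \<phi> \<phi>1 \<phi>2"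
begin

interpretation smooth_map \<phi> \<phi>1 \<phi>2
  by (rule smooth)

lemma inner_grad_x: "a \<bullet> grad_x \<phi> z = \<phi>1 z (a, 0)"
  unfolding grad_x_def using grad_has_derivative[OF has_derivative_fst_part[OF first]] by simp

lemma inner_grad_u: "a \<bullet> grad_u \<phi> z = \<phi>1 z (0, a)"
  unfolding grad_u_def using grad_has_derivative[OF has_derivative_snd_part[OF first]] by simp

text \<open>Differentiated in the whole pair, so that restricting \<open>b\<close> to its state or
  control part yields both \<open>hess_xx\<close> and \<open>hess_xu\<close>.\<close>

lemma has_derivative_grad_x:
  "(grad_x \<phi> has_derivative (\<lambda>b. \<chi> i. \<phi>2 z b (axis i 1, 0))) (at z)"
proof -
  have "grad_x \<phi> = (\<lambda>z. \<chi> i. \<phi>1 z (axis i 1, 0))"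
    using inner_grad_x[of "axis _ 1"] by (simp add: fun_eq_iff vec_eq_iff inner_axis')
  then show ?thesis
    by (auto intro: has_derivative_chi second)
qed

lemma has_derivative_grad_u:
  "(grad_u \<phi> has_derivative (\<lambda>b. \<chi> i. \<phi>2 z b (0, axis i 1))) (at z)"
proof -
  have "grad_u \<phi> = (\<lambda>z. \<chi> i. \<phi>1 z (0, axis i 1))"
    using inner_grad_u[of "axis _ 1"] by (simp add: fun_eq_iff vec_eq_iff inner_axis')
  then show ?thesis
    by (auto intro: has_derivative_chi second)
qed

lemma inner_hess_xx: "a \<bullet> (hess_xx \<phi> z *v b) = \<phi>2 z (b, 0) (a, 0)"
proof -
  have "linear (\<lambda>a. \<phi>2 z (b, 0) (a, 0))"
    using linear_compose[OF _ linear2_right, of "\<lambda>a. (a, 0)"]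
    by (simp add: o_def linear_iff)
  from linear_inner_chi_axis[OF this] show ?thesis
    by (simp add: hess_xx_def jac_x_mult[OF has_derivative_grad_x])
qed

lemma inner_hess_xu: "a \<bullet> (hess_xu \<phi> z *v b) = \<phi>2 z (0, b) (a, 0)"
proof -
  have "linear (\<lambda>a. \<phi>2 z (0, b) (a, 0))"
    using linear_compose[OF _ linear2_right, of "\<lambda>a. (a, 0)"]
    by (simp add: o_def linear_iff)
  from linear_inner_chi_axis[OF this] show ?thesis
    by (simp add: hess_xu_def jac_u_mult[OF has_derivative_grad_x])
qed

lemma inner_hess_uu: "a \<bullet> (hess_uu \<phi> z *v b) = \<phi>2 z (0, b) (0, a)"
proof -
  have "linear (\<lambda>a. \<phi>2 z (0, b) (0, a))"
    using linear_compose[OF _ linear2_right, of "\<lambda>a. (0, a)"]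
    by (simp add: o_def linear_iff)
  from linear_inner_chi_axis[OF this] show ?thesis
    by (simp add: hess_uu_def jac_u_mult[OF has_derivative_grad_u])
qed

end

text \<open>The form \<open>a \<bullet> (A *v b)\<close> is linear in \<open>A\<close>, hence
  commutes with the weighted sum. \<open>H\<close> stays abstract to serve all three blocks.\<close>

lemma inner_weighted:
  assumes "\<And>m. a \<bullet> (H (\<lambda>z. \<phi> z $ m) z *v b) = c $ m"
  shows "a \<bullet> (weighted H q \<phi> z *v b) = c \<bullet> q"
proof -
  have "linear (\<lambda>A. a \<bullet> (A *v b))"
    by (auto intro!: linearI simp: algebra_simps inner_simps scaleR_matrix_vector_assoc[symmetric])
  then have "a \<bullet> (weighted H q \<phi> z *v b) = (\<Sum>m\<in>UNIV. q $ m * (a \<bullet> (H (\<lambda>z. \<phi> z $ m) z *v b)))"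
    unfolding weighted_def by (subst linear_sum[where f="\<lambda>A. a \<bullet> (A *v b)"])
      (simp_all add: scaleR_matrix_vector_assoc[symmetric])
  also have "\<dots> = (\<Sum>m\<in>UNIV. q $ m * c $ m)"
    by (simp only: assms)
  finally show ?thesis
    by (simp add: inner_vec_def mult.commute)
qed

section \<open>Second-order expansion of a single stage\<close>

locale smooth_stage =
  l: smooth_map l l1 l2 + f: smooth_map f f1 f2
  for l :: "(real^'nx) \<times> (real^'nu) \<Rightarrow> real" and l1 l2 and f :: "(real^'nx) \<times> (real^'nu) \<Rightarrow> real^'nx" and f1 f2 +
  fixes z :: "(real^'nx) \<times> (real^'nu)" and \<mu> :: real and q :: "real^'nx"
begin

sublocale f_component: smooth_map "\<lambda>z. f z $ m" "\<lambda>z a. f1 z a $ m" "\<lambda>z b a. f2 z b a $ m" for m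
proof
  show "((\<lambda>z. f z $ m) has_derivative (\<lambda>a. f1 z a $ m)) (at z)" for z
    by (rule bounded_linear.has_derivative[OF bounded_linear_vec_nth f.first])
  show "((\<lambda>z. f1 z a $ m) has_derivative (\<lambda>b. f2 z b a $ m)) (at z)" for z a
    by (rule bounded_linear.has_derivative[OF bounded_linear_vec_nth f.second])
  show "f2 z b a $ m = f2 z a b $ m" for z a b
    by (simp only: f.symmetric[of z b a])
qed

text \<open>\<open>Lxx\<close>, \<open>Lxu\<close>, \<open>Luu\<close> are the Hessian blocks of l +
  (1/\<mu>) f \<bullet> q with the weight \<open>q\<close> frozen, and \<open>L2\<close> is the same
  Hessian as a bilinear form. Later \<open>q\<close> is the weighted residual.\<close>

definition "Lxx = hess_xx l z + (1/\<mu>) *\<^sub>R weighted hess_xx q f z"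
definition "Lxu = hess_xu l z + (1/\<mu>) *\<^sub>R weighted hess_xu q f z"
definition "Luu = hess_uu l z + (1/\<mu>) *\<^sub>R weighted hess_uu q f z"
definition "L2 b a = l2 z b a + (1/\<mu>) * (f2 z b a \<bullet> q)"

lemma inner_Lxx: "a \<bullet> (Lxx *v b) = L2 (b, 0) (a, 0)"
  using inner_hess_xx[OF l.smooth_map_axioms, of a z b]
    inner_weighted[of a hess_xx f z b "f2 z (b, 0) (a, 0)",
      OF inner_hess_xx[OF f_component.smooth_map_axioms]]
  by (simp add: Lxx_def L2_def matrix_vector_mult_add_rdistrib inner_add_right scaleR_matrix_vector_assoc[symmetric])

lemma inner_Lxu: "a \<bullet> (Lxu *v b) = L2 (0, b) (a, 0)"
  using inner_hess_xu[OF l.smooth_map_axioms, of a z b]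
    inner_weighted[of a hess_xu f z b "f2 z (0, b) (a, 0)",
      OF inner_hess_xu[OF f_component.smooth_map_axioms]]
  by (simp add: Lxu_def L2_def matrix_vector_mult_add_rdistrib inner_add_right scaleR_matrix_vector_assoc[symmetric])

lemma inner_Luu: "a \<bullet> (Luu *v b) = L2 (0, b) (0, a)"
  using inner_hess_uu[OF l.smooth_map_axioms, of a z b]
    inner_weighted[of a hess_uu f z b "f2 z (0, b) (0, a)",
      OF inner_hess_uu[OF f_component.smooth_map_axioms]]
  by (simp add: Luu_def L2_def matrix_vector_mult_add_rdistrib inner_add_right scaleR_matrix_vector_assoc[symmetric])

lemma L2_symmetric: "L2 b a = L2 a b"
  by (simp add: L2_def l.symmetric[of z b] f.symmetric[of z b])

lemma L2_add: "L2 (b + b') a = L2 b a + L2 b' a" "L2 b (a + a') = L2 b a + L2 b a'"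
  by (simp_all add: L2_def l.linear_simps f.linear_simps algebra_simps inner_add_left)

lemma Lxx_symmetric: "transpose Lxx = Lxx"
  by (rule symmetric_matrixI) (simp add: inner_Lxx L2_symmetric)

lemma Luu_symmetric: "transpose Luu = Luu"
  by (rule symmetric_matrixI) (simp add: inner_Luu L2_symmetric)

text \<open>Expand bilinearly into four blocks; the control-state block is the transpose of
  \<open>Lxu\<close> by symmetry of \<open>L2\<close>.\<close>

lemma L2_eq: "L2 (b, s) (a, r) = a \<bullet> (Lxx *v b + Lxu *v s) + r \<bullet> (transpose Lxu *v b + Luu *v s)"
proof -
  have "L2 (b, s) (a, r) = L2 ((b, 0) + (0, s)) ((a, 0) + (0, r))"
    by simp
  also have "\<dots> = L2 (b, 0) (a, 0) + L2 (0, s) (a, 0) + (L2 (0, r) (b, 0) + L2 (0, s) (0, r))"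
    by (simp only: L2_add L2_symmetric[of "(b, 0)" "(0, r)"])
  also have "L2 (0, r) (b, 0) = r \<bullet> (transpose Lxu *v b)"
    by (metis inner_Lxu dot_lmul_matrix inner_commute transpose_matrix_vector)
  finally show ?thesis
    by (simp only: inner_Lxx inner_Lxu inner_Luu inner_add_right)
qed

lemma l1_eq: "l1 z (a, r) = a \<bullet> grad_x l z + r \<bullet> grad_u l z"
  using l.linear_simps(1)[of z "(a, 0)" "(0, r)"]
  by (simp add: inner_grad_x[OF l.smooth_map_axioms] inner_grad_u[OF l.smooth_map_axioms])

lemma f1_eq: "f1 z (a, r) = jac_x f z *v a + jac_u f z *v r"
  using f.linear_simps(1)[of z "(a, 0)" "(0, r)"]
  by (simp add: jac_x_mult[OF f.first] jac_u_mult[OF f.first])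

end

subsection \<open>The objective along affine curves\<close>

locale smooth_problem =
  fixes T :: nat and \<mu> :: real
    and f :: "nat \<Rightarrow> (real^'nx) \<times> (real^'nu) \<Rightarrow> real^'nx" and f1 f2
    and l :: "nat \<Rightarrow> (real^'nx) \<times> (real^'nu) \<Rightarrow> real" and l1 l2
    and lT :: "real^'nx \<Rightarrow> real" and lT1 lT2
    and S :: "nat \<Rightarrow> real^'nx^'nx"
  assumes smooth_f: "j < T \<Longrightarrow> smooth_map (f j) (f1 j) (f2 j)"
    and smooth_l: "j < T \<Longrightarrow> smooth_map (l j) (l1 j) (l2 j)"
    and smooth_lT: "smooth_map lT lT1 lT2"
    and symmetric_S: "j < T \<Longrightarrow> transpose (S (j+1)) = S (j+1)"
begin

text \<open>The objective without its prior and measurement terms, which involve only states up to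
  stage t and hence are constant in the coordinates of the last rows. \<open>S\<close> stands for
  the inverses of \<open>Q\<close>.\<close>

definition "F x u = (\<Sum>j<T. l j (x j, u j)) + lT (x T)
  - 1 / (2 * \<mu>) * (\<Sum>j<T. (x (j+1) - f j (x j, u j)) \<bullet> (S (j+1) *v (x (j+1) - f j (x j, u j))))"

definition "F1 x u a b = (\<Sum>j<T. l1 j (x j, u j) (a j, b j)) + lT1 (x T) (a T)
  - 1 / \<mu> * (\<Sum>j<T. (a (j+1) - f1 j (x j, u j) (a j, b j)) \<bullet> (S (j+1) *v (x (j+1) - f j (x j, u j))))"

text \<open>Derivative of \<open>F1\<close> in the direction (p, q) with (a, b) fixed. The
  \<open>f2\<close> term comes from the dependence of the linearised residual on the base
  point.\<close>

definition "F2 x u p q a b = (\<Sum>j<T. l2 j (x j, u j) (p j, q j) (a j, b j)) + lT2 (x T) (p T) (a T)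
  - 1 / \<mu> * (\<Sum>j<T. (a (j+1) - f1 j (x j, u j) (a j, b j)) \<bullet> (S (j+1) *v (p (j+1) - f1 j (x j, u j) (p j, q j)))
      - f2 j (x j, u j) (p j, q j) (a j, b j) \<bullet> (S (j+1) *v (x (j+1) - f j (x j, u j))))"

lemma DERIV_inner_matrix:
  fixes A :: "real^'n^'m"
  assumes "(r has_vector_derivative r') (at s)" "(r2 has_vector_derivative r2') (at s)"
  shows "((\<lambda>s. r s \<bullet> (A *v r2 s)) has_real_derivative r s \<bullet> (A *v r2') + r' \<bullet> (A *v r2 s)) (at s)"
  unfolding has_real_derivative_iff_has_vector_derivative
  by (rule bounded_bilinear.has_vector_derivative[OF bounded_bilinear_inner assms(1)
        bounded_linear.has_vector_derivative[OF matrix_vector_mul_bounded_linear assms(2)]])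

text \<open>Differentiation along a general curve; the one-coordinate changes behind partial
  derivatives are the instances used later.\<close>

context
  fixes X :: "real \<Rightarrow> nat \<Rightarrow> real^'nx" and U :: "real \<Rightarrow> nat \<Rightarrow> real^'nu" and a b s
  assumes X: "\<And>j. ((\<lambda>s. X s j) has_vector_derivative a j) (at s)"
    and U: "\<And>j. ((\<lambda>s. U s j) has_vector_derivative b j) (at s)"
begin

lemma curve_pair: "((\<lambda>s. (X s j, U s j)) has_vector_derivative (a j, b j)) (at s)"
  by (rule has_vector_derivative_Pair[OF X U])

lemma DERIV_F: "((\<lambda>s. F (X s) (U s)) has_real_derivative F1 (X s) (U s) a b) (at s)"
proof -
  have r: "((\<lambda>s. X s (j+1) - f j (X s j, U s j)) has_vector_derivative
      a (j+1) - f1 j (X s j, U s j) (a j, b j)) (at s)" if "j < T" for j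
    by (intro has_vector_derivative_diff X smooth_map.along_curve(1)[OF smooth_f[OF that] curve_pair])
  have l: "((\<lambda>s. l j (X s j, U s j)) has_real_derivative l1 j (X s j, U s j) (a j, b j)) (at s)"
    if "j < T" for j
    unfolding has_real_derivative_iff_has_vector_derivative
    by (rule smooth_map.along_curve(1)[OF smooth_l[OF that] curve_pair])
  have lT: "((\<lambda>s. lT (X s T)) has_real_derivative lT1 (X s T) (a T)) (at s)"
    unfolding has_real_derivative_iff_has_vector_derivative
    by (rule smooth_map.along_curve(1)[OF smooth_lT X])
  let ?r = "\<lambda>j. X s (j+1) - f j (X s j, U s j)"
    and ?r' = "\<lambda>j. a (j+1) - f1 j (X s j, U s j) (a j, b j)"
  have "((\<lambda>s. F (X s) (U s)) has_real_derivative
      (\<Sum>j<T. l1 j (X s j, U s j) (a j, b j)) + lT1 (X s T) (a T)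
      - 1 / (2 * \<mu>) * (\<Sum>j<T. ?r j \<bullet> (S (j+1) *v ?r' j) + ?r' j \<bullet> (S (j+1) *v ?r j))) (at s)"
    unfolding F_def
    by (intro DERIV_diff DERIV_add DERIV_sum DERIV_cmult l lT DERIV_inner_matrix r; simp)
  \<comment> \<open>The two halves of the product rule agree by symmetry of \<open>S\<close>; the
    factor 2 turns 1/(2\<mu>) into 1/\<mu>.\<close>
  moreover have "(\<Sum>j<T. ?r j \<bullet> (S (j+1) *v ?r' j) + ?r' j \<bullet> (S (j+1) *v ?r j)) =
      2 * (\<Sum>j<T. ?r' j \<bullet> (S (j+1) *v ?r j))"
    unfolding sum_distrib_left
    using inner_symmetric_matrix[OF symmetric_S] by (intro sum.cong) auto
  ultimately show ?thesis
    by (simp add: F1_def)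
qed

lemma DERIV_F1: "((\<lambda>s. F1 (X s) (U s) c d) has_real_derivative F2 (X s) (U s) a b c d) (at s)"
proof -
  have r: "((\<lambda>s. X s (j+1) - f j (X s j, U s j)) has_vector_derivative
      a (j+1) - f1 j (X s j, U s j) (a j, b j)) (at s)" if "j < T" for j
    by (intro has_vector_derivative_diff X smooth_map.along_curve(1)[OF smooth_f[OF that] curve_pair])
  have r1: "((\<lambda>s. c (j+1) - f1 j (X s j, U s j) (c j, d j)) has_vector_derivative
      0 - f2 j (X s j, U s j) (a j, b j) (c j, d j)) (at s)" if "j < T" for j
    by (intro has_vector_derivative_diff has_vector_derivative_const smooth_map.along_curve(2)[OF smooth_f[OF that] curve_pair])
  have l: "((\<lambda>s. l1 j (X s j, U s j) (c j, d j)) has_real_derivative l2 j (X s j, U s j) (a j, b j) (c j, d j)) (at s)"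
    if "j < T" for j
    unfolding has_real_derivative_iff_has_vector_derivative
    by (rule smooth_map.along_curve(2)[OF smooth_l[OF that] curve_pair])
  have lT: "((\<lambda>s. lT1 (X s T) (c T)) has_real_derivative lT2 (X s T) (a T) (c T)) (at s)"
    unfolding has_real_derivative_iff_has_vector_derivative
    by (rule smooth_map.along_curve(2)[OF smooth_lT X])
  have "((\<lambda>s. F1 (X s) (U s) c d) has_real_derivative
      (\<Sum>j<T. l2 j (X s j, U s j) (a j, b j) (c j, d j)) + lT2 (X s T) (a T) (c T)
      - 1 / \<mu> * (\<Sum>j<T. (c (j+1) - f1 j (X s j, U s j) (c j, d j)) \<bullet>
            (S (j+1) *v (a (j+1) - f1 j (X s j, U s j) (a j, b j)))
          + (0 - f2 j (X s j, U s j) (a j, b j) (c j, d j)) \<bullet> (S (j+1) *v (X s (j+1) - f j (X s j, U s j))))) (at s)"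
    unfolding F1_def
    by (intro DERIV_diff DERIV_add DERIV_sum DERIV_cmult l lT DERIV_inner_matrix r r1; simp)
  then show ?thesis
    by (simp add: F2_def)
qed

end

lemma F2_linear:
  "F2 x u (\<lambda>j. r *\<^sub>R p j + p' j) (\<lambda>j. r *\<^sub>R q j + q' j) a b = r * F2 x u p q a b + F2 x u p' q' a b"
proof -
  have *: "\<phi> (r *\<^sub>R p j + p' j, r *\<^sub>R q j + q' j) = r *\<^sub>R \<phi> (p j, q j) + \<phi> (p' j, q' j)" if "linear \<phi>"
    for j and \<phi> :: "_ \<Rightarrow> 'c::real_vector"
    using linear_add[OF that, of "r *\<^sub>R (p j, q j)" "(p' j, q' j)"] linear_scale[OF that, of r "(p j, q j)"] by simp
  note f1 = *[OF smooth_map.linear1[OF smooth_f]] and f2 = *[OF smooth_map.linear2_left[OF smooth_f]]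
    and l2 = *[OF smooth_map.linear2_left[OF smooth_l]]
  let ?z = "\<lambda>j. (x j, u j)"
  let ?q = "\<lambda>p q j. (a (j+1) - f1 j (?z j) (a j, b j)) \<bullet> (S (j+1) *v (p (j+1) - f1 j (?z j) (p j, q j)))
      - f2 j (?z j) (p j, q j) (a j, b j) \<bullet> (S (j+1) *v (x (j+1) - f j (?z j)))"
  have "(\<Sum>j<T. l2 j (?z j) (r *\<^sub>R p j + p' j, r *\<^sub>R q j + q' j) (a j, b j)) =
      r * (\<Sum>j<T. l2 j (?z j) (p j, q j) (a j, b j)) + (\<Sum>j<T. l2 j (?z j) (p' j, q' j) (a j, b j))"
    by (simp add: l2 sum_distrib_left sum.distrib)
  moreover have "?q (\<lambda>j. r *\<^sub>R p j + p' j) (\<lambda>j. r *\<^sub>R q j + q' j) j = r * ?q p q j + ?q p' q' j" if "j < T" for j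
    by (simp only: f1[OF that] f2[OF that]) (simp add: matrix_vector_right_distrib matrix_vector_mult_diff_distrib
        matrix_vector_mult_scaleR inner_simps algebra_simps)
  then have "(\<Sum>j<T. ?q (\<lambda>j. r *\<^sub>R p j + p' j) (\<lambda>j. r *\<^sub>R q j + q' j) j) =
      r * (\<Sum>j<T. ?q p q j) + (\<Sum>j<T. ?q p' q' j)"
    by (simp only: sum_distrib_left sum.distrib[symmetric]) (intro sum.cong; simp)
  ultimately show ?thesis
    unfolding F2_def by (simp only: smooth_map.linear_simps[OF smooth_lT]) (simp add: algebra_simps add_divide_distrib)
qed

text \<open>Turns the sum over the entries of a Hessian row into a single second derivative in the
  stacked direction.\<close>

lemma F2_sum:
  assumes "finite D"
  shows "F2 x u (\<lambda>j. \<Sum>d\<in>D. s d *\<^sub>R p d j) (\<lambda>j. \<Sum>d\<in>D. s d *\<^sub>R q d j) a b = (\<Sum>d\<in>D. s d * F2 x u (p d) (q d) a b)"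
  using assms
proof induction
  case empty
  \<comment> \<open>Linearity at zero directions with factor 1 says that the value equals twice
    itself.\<close>
  have "F2 x u (\<lambda>j. 0) (\<lambda>j. 0) a b = 0"
    using F2_linear[of x u 1 "\<lambda>j. 0" "\<lambda>j. 0" "\<lambda>j. 0" "\<lambda>j. 0" a b] by simp
  then show ?case
    by simp
next
  case (insert d D)
  then show ?case
    by (simp add: F2_linear)
qed

lemma F2_cong:
  assumes "\<And>j. j \<le> T \<Longrightarrow> p j = p' j" "\<And>j. j < T \<Longrightarrow> q j = q' j"
  shows "F2 x u p q a b = F2 x u p' q' a b"
  unfolding F2_def using assms
  by (auto intro!: arg_cong2[where f="(-)"] arg_cong2[where f="(/)"] sum.cong simp: Suc_leI less_imp_le)

end

text \<open>The left side is the share of one stage in \<open>F1\<close> plus \<open>F2\<close>. The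
  terms pairing a' - f1 z (a, b) with the residual and with its linear variation merge into
  \<open>lam\<close>; the remaining curvature of \<open>f\<close> joins \<open>l2\<close> to form
  \<open>L2\<close>. Grouping by \<open>a\<close>, \<open>b\<close> and \<open>a'\<close> separates
  the rows.\<close>

lemma (in smooth_stage) stage_variation:
  assumes q: "q = S *v r"
    and lam: "lam = (1/\<mu>) *\<^sub>R (S *v (r + (p' - (jac_x f z *v p + jac_u f z *v s))))"
  shows "l1 z (a, b) + l2 z (p, s) (a, b) - 1/\<mu> * ((a' - f1 z (a, b)) \<bullet> (S *v r))
      - 1/\<mu> * ((a' - f1 z (a, b)) \<bullet> (S *v (p' - f1 z (p, s))) - f2 z (p, s) (a, b) \<bullet> (S *v r)) =
    a \<bullet> (grad_x l z + Lxx *v p + Lxu *v s + transpose (jac_x f z) *v lam)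
    + b \<bullet> (grad_u l z + transpose Lxu *v p + Luu *v s + transpose (jac_u f z) *v lam) - a' \<bullet> lam"
proof -
  have "l2 z (p, s) (a, b) + 1/\<mu> * (f2 z (p, s) (a, b) \<bullet> q) =
      a \<bullet> (Lxx *v p + Lxu *v s) + b \<bullet> (transpose Lxu *v p + Luu *v s)"
    using L2_eq[of p s a b] unfolding L2_def .
  moreover have "1/\<mu> * ((a' - f1 z (a, b)) \<bullet> q) + 1/\<mu> * ((a' - f1 z (a, b)) \<bullet> (S *v (p' - f1 z (p, s)))) =
      (a' - f1 z (a, b)) \<bullet> lam"
    unfolding lam f1_eq by (simp add: matrix_vector_right_distrib q[symmetric] inner_simps algebra_simps)
  moreover have "f1 z (a, b) \<bullet> lam = a \<bullet> (transpose (jac_x f z) *v lam) + b \<bullet> (transpose (jac_u f z) *v lam)"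
    unfolding f1_eq
    by (simp add: inner_simps) (metis dot_lmul_matrix inner_commute)
  ultimately show ?thesis
    unfolding q[symmetric] l1_eq inner_simps by (simp only: right_diff_distrib)
qed

section \<open>Coordinate directions of the stacked vector\<close>

lemma xpart_fun_upd: "xpart (z(c := s)) j = xpart z j + (s - z c) *\<^sub>R xpart (indicator {c}) j"
  by (auto simp: xpart_def vec_eq_iff indicator_def)

lemma upart_fun_upd: "upart (z(c := s)) j = upart z j + (s - z c) *\<^sub>R upart (indicator {c}) j"
  by (auto simp: upart_def vec_eq_iff indicator_def)

lemma xpart_indicator: "xpart (indicator {XC k i}) j = (if j = k then axis i 1 else 0)" "xpart (indicator {UC k m}) j = 0"
  by (auto simp: xpart_def vec_eq_iff indicator_def axis_def)

lemma upart_indicator: "upart (indicator {UC k i}) j = (if j = k then axis i 1 else 0)" "upart (indicator {XC k m}) j = 0"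
  by (auto simp: upart_def vec_eq_iff indicator_def axis_def)

lemma xpart_stack [simp]: "xpart (stack x u) = x"
  by (simp add: xpart_def stack_def fun_eq_iff)

lemma upart_stack [simp]: "upart (stack x u) = u"
  by (simp add: upart_def stack_def fun_eq_iff)

lemma ball_last_rows:
  "(\<forall>c\<in>last_rows T t. X c) \<longleftrightarrow>
    (\<forall>k. t < k \<and> k \<le> T \<longrightarrow> (\<forall>i. X (XC k i))) \<and> (\<forall>k. t \<le> k \<and> k < T \<longrightarrow> (\<forall>i. X (UC k i)))"
  unfolding last_rows_def by blast

lemma sum_mult_indicator_singleton:
  fixes z :: "'a \<Rightarrow> real"
  assumes "finite D"
  shows "(\<Sum>d\<in>D. z d * indicator {d} c) = (if c \<in> D then z c else 0)"
proof -
  have "(\<Sum>d\<in>D. z d * indicator {d} c) = (\<Sum>d\<in>D. if d = c then z d else 0)"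
    by (intro sum.cong) auto
  then show ?thesis
    using assms by simp
qed

lemma sum_xpart_indicator:
  fixes z :: "('nx::finite, 'nu::finite) coord \<Rightarrow> real"
  shows "j \<le> T \<Longrightarrow> (\<Sum>d\<in>variables T t. z d *\<^sub>R xpart (indicator {d}) j) = xpart z j"
  by (simp add: xpart_def vec_eq_iff sum_mult_indicator_singleton del: sum_mult_indicator) (simp add: variables_def)

text \<open>Controls below \<open>t\<close> are not variables, so no summand reaches them and the
  direction vanishes there.\<close>

lemma sum_upart_indicator:
  fixes z :: "('nx::finite, 'nu::finite) coord \<Rightarrow> real"
  shows "j < T \<Longrightarrow> (\<Sum>d\<in>variables T t. z d *\<^sub>R upart (indicator {d}) j) = (if t \<le> j then upart z j else 0)"
  by (simp add: upart_def vec_eq_iff sum_mult_indicator_singleton del: sum_mult_indicator) (simp add: variables_def)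

definition controls :: "nat \<Rightarrow> (nat \<Rightarrow> real^'nu) \<Rightarrow> (('nx, 'nu::finite) coord \<Rightarrow> real) \<Rightarrow> nat \<Rightarrow> real^'nu" where
  "controls t up z j = (if j < t then up j else upart z j)"

text \<open>Membership in \<open>variables T t\<close> excludes control coordinates below
  \<open>t\<close>, where changing \<open>z\<close> would not change
  \<open>controls\<close>.\<close>

lemma controls_fun_upd:
  assumes "c \<in> variables T t"
  shows "controls t up (z(c := s)) j = controls t up z j + (s - z c) *\<^sub>R upart (indicator {c}) j"
  using assms by (auto simp: controls_def upart_fun_upd variables_def upart_indicator)

section \<open>Entries of the gradient and the Hessian\<close>

context smooth_problem
begin

context
  fixes H :: "(('nx, 'nu) coord \<Rightarrow> real) \<Rightarrow> real" and K t up
  assumes H: "\<And>z. H z = F (xpart z) (controls t up z) + K z"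
begin

lemma partial_deriv_eq:
  assumes c: "c \<in> variables T t" and K: "\<And>z s. K (z(c := s)) = K z"
  shows "partial_deriv c H z = F1 (xpart z) (controls t up z) (xpart (indicator {c})) (upart (indicator {c}))"
proof -
  have "((\<lambda>s. F (xpart (z(c := s))) (controls t up (z(c := s))) + K z) has_real_derivative
      F1 (xpart (z(c := z c))) (controls t up (z(c := z c))) (xpart (indicator {c})) (upart (indicator {c})) + 0) (at (z c))"
    by (intro DERIV_add DERIV_const DERIV_F; unfold xpart_fun_upd controls_fun_upd[OF c])
      (auto intro!: derivative_eq_intros)
  then show ?thesis
    unfolding partial_deriv_def H K by (simp add: DERIV_imp_deriv)
qed

text \<open>Since \<open>K\<close> is constant in \<open>c\<close> at every point, the first partial
  derivative is free of \<open>K\<close> everywhere. The second may therefore be taken in any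
  variable \<open>d\<close>, even one on which \<open>K\<close> depends.\<close>

lemma hessian_eq:
  assumes c: "c \<in> variables T t" and K: "\<And>z s. K (z(c := s)) = K z" and d: "d \<in> variables T t"
  shows "hessian H z c d = F2 (xpart z) (controls t up z) (xpart (indicator {d})) (upart (indicator {d}))
     (xpart (indicator {c})) (upart (indicator {c}))"
proof -
  have "((\<lambda>s. partial_deriv c H (z(d := s))) has_real_derivative
     F2 (xpart (z(d := z d))) (controls t up (z(d := z d))) (xpart (indicator {d})) (upart (indicator {d}))
     (xpart (indicator {c})) (upart (indicator {c}))) (at (z d))"
    unfolding partial_deriv_eq[OF c K]
    by (intro DERIV_F1; unfold xpart_fun_upd controls_fun_upd[OF d])
      (auto intro!: derivative_eq_intros)
  then show ?thesis
    unfolding hessian_def partial_deriv_def[of d] by (simp add: DERIV_imp_deriv)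
qed

lemma hessian_row:
  assumes c: "c \<in> variables T t" and K: "\<And>z s. K (z(c := s)) = K z"
  shows "(\<Sum>d\<in>variables T t. hessian H z c d * p d) =
    F2 (xpart z) (controls t up z) (xpart p) (\<lambda>j. if t \<le> j then upart p j else 0)
     (xpart (indicator {c})) (upart (indicator {c}))"
proof -
  have "(\<Sum>d\<in>variables T t. hessian H z c d * p d) =
    F2 (xpart z) (controls t up z) (\<lambda>j. \<Sum>d\<in>variables T t. p d *\<^sub>R xpart (indicator {d}) j)
      (\<lambda>j. \<Sum>d\<in>variables T t. p d *\<^sub>R upart (indicator {d}) j) (xpart (indicator {c})) (upart (indicator {c}))"
    by (simp add: F2_sum hessian_eq[OF c K] mult.commute)
  also have "\<dots> = F2 (xpart z) (controls t up z) (xpart p) (\<lambda>j. if t \<le> j then upart p j else 0)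
     (xpart (indicator {c})) (upart (indicator {c}))"
    by (intro F2_cong sum_xpart_indicator sum_upart_indicator)
  finally show ?thesis .
qed

end

text \<open>\<open>stage_variation\<close> summed over the stages: \<alpha> and \<beta> collect the
  coefficients of the current state and control, \<open>lam (j+1)\<close> that of the next
  state.\<close>

lemma F1_plus_F2:
  assumes r: "\<And>j. j < T \<Longrightarrow> r (j+1) = x (j+1) - f j (x j, u j)"
    and lam: "\<And>j. j < T \<Longrightarrow> lam (j+1) = (1/\<mu>) *\<^sub>R (S (j+1) *v
        (r (j+1) + (p (j+1) - (jac_x (f j) (x j, u j) *v p j + jac_u (f j) (x j, u j) *v q j))))"
    and \<alpha>: "\<And>j. j < T \<Longrightarrow> \<alpha> j = grad_x (l j) (x j, u j)
        + (hess_xx (l j) (x j, u j) + (1/\<mu>) *\<^sub>R weighted hess_xx (S (j+1) *v r (j+1)) (f j) (x j, u j)) *v p j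
        + Lxu j *v q j + transpose (jac_x (f j) (x j, u j)) *v lam (j+1)"
    and \<beta>: "\<And>j. j < T \<Longrightarrow> \<beta> j = grad_u (l j) (x j, u j) + transpose (Lxu j) *v p j
        + (hess_uu (l j) (x j, u j) + (1/\<mu>) *\<^sub>R weighted hess_uu (S (j+1) *v r (j+1)) (f j) (x j, u j)) *v q j
        + transpose (jac_u (f j) (x j, u j)) *v lam (j+1)"
    and Lxu: "\<And>j. j < T \<Longrightarrow> Lxu j =
        hess_xu (l j) (x j, u j) + (1/\<mu>) *\<^sub>R weighted hess_xu (S (j+1) *v r (j+1)) (f j) (x j, u j)"
  shows "F1 x u a b + F2 x u p q a b =
    (\<Sum>j<T. a j \<bullet> \<alpha> j + b j \<bullet> \<beta> j - a (j+1) \<bullet> lam (j+1)) + a T \<bullet> (grad lT (x T) + hess lT (x T) *v p T)"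
proof -
  let ?z = "\<lambda>j. (x j, u j)"
  have "F1 x u a b + F2 x u p q a b =
    (\<Sum>j<T. l1 j (?z j) (a j, b j) + l2 j (?z j) (p j, q j) (a j, b j)
      - 1/\<mu> * ((a (j+1) - f1 j (?z j) (a j, b j)) \<bullet> (S (j+1) *v r (j+1)))
      - 1/\<mu> * ((a (j+1) - f1 j (?z j) (a j, b j)) \<bullet> (S (j+1) *v (p (j+1) - f1 j (?z j) (p j, q j)))
          - f2 j (?z j) (p j, q j) (a j, b j) \<bullet> (S (j+1) *v r (j+1))))
    + (lT1 (x T) (a T) + lT2 (x T) (p T) (a T))"
    unfolding F1_def F2_def using r
    by (simp add: sum.distrib sum_subtractf sum_distrib_left[symmetric] sum_divide_distrib[symmetric])
  also have "(\<Sum>j<T. l1 j (?z j) (a j, b j) + l2 j (?z j) (p j, q j) (a j, b j)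
      - 1/\<mu> * ((a (j+1) - f1 j (?z j) (a j, b j)) \<bullet> (S (j+1) *v r (j+1)))
      - 1/\<mu> * ((a (j+1) - f1 j (?z j) (a j, b j)) \<bullet> (S (j+1) *v (p (j+1) - f1 j (?z j) (p j, q j)))
          - f2 j (?z j) (p j, q j) (a j, b j) \<bullet> (S (j+1) *v r (j+1)))) =
     (\<Sum>j<T. a j \<bullet> \<alpha> j + b j \<bullet> \<beta> j - a (j+1) \<bullet> lam (j+1))"
  proof (rule sum.cong[OF refl])
    fix j assume "j \<in> {..<T}"
    then have j: "j < T"
      by simp
    interpret smooth_stage "l j" "l1 j" "l2 j" "f j" "f1 j" "f2 j" "(x j, u j)" \<mu> "S (j+1) *v r (j+1)"
      using smooth_l[OF j] smooth_f[OF j] by (simp add: smooth_stage_def)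
    show "l1 j (?z j) (a j, b j) + l2 j (?z j) (p j, q j) (a j, b j)
      - 1/\<mu> * ((a (j+1) - f1 j (?z j) (a j, b j)) \<bullet> (S (j+1) *v r (j+1)))
      - 1/\<mu> * ((a (j+1) - f1 j (?z j) (a j, b j)) \<bullet> (S (j+1) *v (p (j+1) - f1 j (?z j) (p j, q j)))
          - f2 j (?z j) (p j, q j) (a j, b j) \<bullet> (S (j+1) *v r (j+1))) =
       a j \<bullet> \<alpha> j + b j \<bullet> \<beta> j - a (j+1) \<bullet> lam (j+1)"
      using stage_variation[OF refl lam[OF j], of "a j" "b j" "a (j+1)"]
      unfolding \<alpha>[OF j] \<beta>[OF j] Lxu[OF j] Lxx_def Lxu_def Luu_def .
  qed
  also have "lT1 (x T) (a T) + lT2 (x T) (p T) (a T) = a T \<bullet> (grad lT (x T) + hess lT (x T) *v p T)"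
    by (simp add: inner_add_right grad_has_derivative[OF smooth_map.first[OF smooth_lT]]
        inner_hess[OF smooth_lT])
  finally show ?thesis .
qed

end

section \<open>Reading off individual rows\<close>

lemma inner_if_zero: "(if P then a else 0) \<bullet> b = (if P then a \<bullet> b else 0)"
  by simp

text \<open>State \<open>k\<close> occurs as the next state in summand k - 1, which exists because
  \<open>0 < k\<close>, and as the current state in summand \<open>k\<close>, or in the terminal
  term if k = T.\<close>

lemma sum_xpart_indicator_state:
  assumes "0 < k" "k \<le> T"
  shows "(\<Sum>j<T. xpart (indicator {XC k i}) j \<bullet> \<alpha> j + upart (indicator {XC k i}) j \<bullet> \<beta> j - xpart (indicator {XC k i}) (j+1) \<bullet> lam (j+1))
     + xpart (indicator {XC k i}) T \<bullet> \<kappa> = ((if k = T then \<kappa> else \<alpha> k) - lam k) $ i"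
proof -
  obtain m where m: "k = Suc m" "m < T"
    using assms by (cases k) auto
  then show ?thesis
    by (auto simp: xpart_indicator upart_indicator sum.distrib sum_subtractf inner_if_zero inner_axis' cong: if_cong)
qed

lemma sum_upart_indicator_control:
  assumes "k < T"
  shows "(\<Sum>j<T. xpart (indicator {UC k i}) j \<bullet> \<alpha> j + upart (indicator {UC k i}) j \<bullet> \<beta> j - xpart (indicator {UC k i}) (j+1) \<bullet> lam (j+1))
     + xpart (indicator {UC k i}) T \<bullet> \<kappa> = \<beta> k $ i"
  using assms by (auto simp: xpart_indicator upart_indicator sum.distrib inner_if_zero inner_axis' cong: if_cong)

subsection \<open>The Newton recursion\<close>

theorem proposition1:
  fixes T t :: nat and \<mu> :: real
    and f :: "nat \<Rightarrow> (real^'nx) \<times> (real^'nu) \<Rightarrow> real^'nx"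
    and h :: "nat \<Rightarrow> real^'nx \<Rightarrow> real^'ny"
    and l :: "nat \<Rightarrow> (real^'nx) \<times> (real^'nu) \<Rightarrow> real"
    and lT :: "real^'nx \<Rightarrow> real"
    and P :: "real^'nx^'nx" and Q :: "nat \<Rightarrow> real^'nx^'nx" and R :: "nat \<Rightarrow> real^'ny^'ny"
    and up :: "nat \<Rightarrow> real^'nu" and y :: "nat \<Rightarrow> real^'ny" and xhat :: "real^'nx"
    and xi :: "nat \<Rightarrow> real^'nx" and ui :: "nat \<Rightarrow> real^'nu"
    and w :: "nat \<Rightarrow> real^'nx" and \<gamma> :: "nat \<Rightarrow> real^'ny"
    and fx :: "nat \<Rightarrow> real^'nx^'nx" and fu :: "nat \<Rightarrow> real^'nu^'nx"
    and lx :: "nat \<Rightarrow> real^'nx" and lu :: "nat \<Rightarrow> real^'nu"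
    and lbar_xx :: "nat \<Rightarrow> real^'nx^'nx" and lbar_xu :: "nat \<Rightarrow> real^'nu^'nx"
    and lbar_ux :: "nat \<Rightarrow> real^'nx^'nu" and lbar_uu :: "nat \<Rightarrow> real^'nu^'nu"
    and \<Gamma> V :: "nat \<Rightarrow> real^'nx^'nx" and v :: "nat \<Rightarrow> real^'nx"
    and Quu :: "nat \<Rightarrow> real^'nu^'nu" and Qux :: "nat \<Rightarrow> real^'nx^'nu" and Qu :: "nat \<Rightarrow> real^'nu"
    and G :: "nat \<Rightarrow> real^'nx^'nu" and g :: "nat \<Rightarrow> real^'nu"
    and px :: "nat \<Rightarrow> real^'nx" and pu :: "nat \<Rightarrow> real^'nu"
  assumes "1 \<le> T" and "t \<le> T" and "0 < \<mu>"
    and f_C2: "\<And>j. j < T \<Longrightarrow> C2 (f j)"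
    and h_C2: "\<And>j. 1 \<le> j \<Longrightarrow> j \<le> t \<Longrightarrow> C2 (h j)"
    and l_C2: "\<And>j. j < T \<Longrightarrow> C2 (l j)"
    and lT_C2: "C2 lT"
    and P_pos: "sym_pos_def P"
    and Q_pos: "\<And>j. 1 \<le> j \<Longrightarrow> j \<le> T \<Longrightarrow> sym_pos_def (Q j)"
    and R_pos: "\<And>j. 1 \<le> j \<Longrightarrow> j \<le> t \<Longrightarrow> sym_pos_def (R j)"
    and ui_past: "\<And>k. k < t \<Longrightarrow> ui k = up k"
    and w: "\<And>k. k < T \<Longrightarrow> w (k+1) = xi (k+1) - f k (xi k, ui k)"
    and \<gamma>: "\<And>k. 1 \<le> k \<Longrightarrow> k \<le> t \<Longrightarrow> \<gamma> k = y k - h k (xi k)"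
    and fx: "\<And>k. k < T \<Longrightarrow> fx k = jac_x (f k) (xi k, ui k)"
    and fu: "\<And>k. k < T \<Longrightarrow> fu k = jac_u (f k) (xi k, ui k)"
    and lx: "\<And>k. k < T \<Longrightarrow> lx k = grad_x (l k) (xi k, ui k)"
    and lu: "\<And>k. k < T \<Longrightarrow> lu k = grad_u (l k) (xi k, ui k)"
    and lbar_xx: "\<And>k. k < T \<Longrightarrow> lbar_xx k =
        hess_xx (l k) (xi k, ui k)
        + (1/\<mu>) *\<^sub>R weighted hess_xx (w (k+1) v* matrix_inv (Q (k+1))) (f k) (xi k, ui k)
        + (if 1 \<le> k \<and> k \<le> t
           then (1/\<mu>) *\<^sub>R weighted hess (\<gamma> k v* matrix_inv (R k)) (h k) (xi k) else 0)"
    and lbar_xu: "\<And>k. k < T \<Longrightarrow> lbar_xu k =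
        hess_xu (l k) (xi k, ui k)
        + (1/\<mu>) *\<^sub>R weighted hess_xu (w (k+1) v* matrix_inv (Q (k+1))) (f k) (xi k, ui k)"
    and lbar_ux: "\<And>k. k < T \<Longrightarrow> lbar_ux k = transpose (lbar_xu k)"
    and lbar_uu: "\<And>k. k < T \<Longrightarrow> lbar_uu k =
        hess_uu (l k) (xi k, ui k)
        + (1/\<mu>) *\<^sub>R weighted hess_uu (w (k+1) v* matrix_inv (Q (k+1))) (f k) (xi k, ui k)"
    and \<Gamma>: "\<And>k. t \<le> k \<Longrightarrow> k < T \<Longrightarrow> \<Gamma> (k+1) = mat 1 - \<mu> *\<^sub>R (V (k+1) ** Q (k+1))"
    and Quu: "\<And>k. t \<le> k \<Longrightarrow> k < T \<Longrightarrow> Quu k =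
        lbar_uu k + transpose (fu k) ** matrix_inv (\<Gamma> (k+1)) ** V (k+1) ** fu k"
    and Qux: "\<And>k. t \<le> k \<Longrightarrow> k < T \<Longrightarrow> Qux k =
        lbar_ux k + transpose (fu k) ** matrix_inv (\<Gamma> (k+1)) ** V (k+1) ** fx k"
    and Qu: "\<And>k. t \<le> k \<Longrightarrow> k < T \<Longrightarrow> Qu k =
        lu k + (transpose (fu k) ** matrix_inv (\<Gamma> (k+1))) *v (v (k+1) - V (k+1) *v w (k+1))"
    and G: "\<And>k. t \<le> k \<Longrightarrow> k < T \<Longrightarrow> G k = - (matrix_inv (Quu k) ** Qux k)"
    and g: "\<And>k. t \<le> k \<Longrightarrow> k < T \<Longrightarrow> g k = - (matrix_inv (Quu k) *v Qu k)"
    and V: "\<And>k. t \<le> k \<Longrightarrow> k < T \<Longrightarrow> V k =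
        lbar_xx k + transpose (fx k) ** matrix_inv (\<Gamma> (k+1)) ** V (k+1) ** fx k
        + transpose (Qux k) ** G k"
    and v: "\<And>k. t \<le> k \<Longrightarrow> k < T \<Longrightarrow> v k =
        lx k + (transpose (fx k) ** matrix_inv (\<Gamma> (k+1))) *v (v (k+1) - V (k+1) *v w (k+1))
        + transpose (Qux k) *v g k"
    and V_T: "V T = hess lT (xi T)"
    and v_T: "v T = grad lT (xi T)"
    and \<Gamma>_inv: "\<And>k. t \<le> k \<Longrightarrow> k < T \<Longrightarrow> invertible (\<Gamma> (k+1))"
    and Quu_inv: "\<And>k. t \<le> k \<Longrightarrow> k < T \<Longrightarrow> invertible (Quu k)"
  shows "(\<forall>c\<in>last_rows T t.
            (\<Sum>d\<in>variables T t.
               hessian (J T t \<mu> f h l lT P Q R up y xhat) (stack xi ui) c d * stack px pu d)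
            = - gradient (J T t \<mu> f h l lT P Q R up y xhat) (stack xi ui) c)
         \<longleftrightarrow>
         (\<forall>k. t \<le> k \<and> k < T \<longrightarrow>
            pu k = G k *v px k + g k \<and>
            px (k+1) = matrix_inv (mat 1 - \<mu> *\<^sub>R (Q (k+1) ** V (k+1))) *v
                         (fx k *v px k + fu k *v pu k + \<mu> *\<^sub>R (Q (k+1) *v v (k+1)) - w (k+1)))"
proof -
  obtain f1 f2 where f12: "\<And>j. j < T \<Longrightarrow> smooth_map (f j) (f1 j) (f2 j)"
    using C2_smooth_map[OF f_C2] by metis
  obtain l1 l2 where l12: "\<And>j. j < T \<Longrightarrow> smooth_map (l j) (l1 j) (l2 j)"
    using C2_smooth_map[OF l_C2] by metis
  obtain lT1 lT2 where lT12: "smooth_map lT lT1 lT2"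
    using C2_smooth_map[OF lT_C2] by metis
  define S where "S j = matrix_inv (Q j)" for j
  have Q_inv: "invertible (Q (j+1))" and Q_sym: "transpose (Q (j+1)) = Q (j+1)" if "j < T" for j
    using Q_pos[of "j+1"] that sym_pos_def_invertible by (auto simp: sym_pos_def_def)
  have S_sym: "transpose (S (j+1)) = S (j+1)" if "j < T" for j
    using Q_inv[OF that] Q_sym[OF that] by (metis S_def matrix_inv_transpose)
  interpret smooth_problem T \<mu> f f1 f2 l l1 l2 lT lT1 lT2 S
    using f12 l12 lT12 S_sym by (rule smooth_problem.intro)
  let ?J = "J T t \<mu> f h l lT P Q R up y xhat"
  \<comment> \<open>\<open>pu\<close> is arbitrary below \<open>t\<close>, where the controls are data and the direction vanishes.\<close>
  define q where "q j = (if t \<le> j then pu j else 0)" for j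
  \<comment> \<open>At index 0 truncated subtraction gives a meaningless value; only positive
    indices are used.\<close>
  define lam where "lam j = (1/\<mu>) *\<^sub>R (S j *v (w j + (px j - (fx (j-1) *v px (j-1) + fu (j-1) *v q (j-1)))))" for j
  have lam_Suc: "lam (j+1) = (1/\<mu>) *\<^sub>R (S (j+1) *v (w (j+1) + (px (j+1) - (fx j *v px j + fu j *v q j))))" for j
    by (simp add: lam_def)
  \<comment> \<open>This is \<open>lbar_xx\<close> without the measurement curvature, because
    \<open>F\<close> omits the measurements; the two agree beyond stage t.\<close>
  define LX where "LX j = hess_xx (l j) (xi j, ui j)
      + (1/\<mu>) *\<^sub>R weighted hess_xx (S (j+1) *v w (j+1)) (f j) (xi j, ui j)" for j
  define \<alpha> where "\<alpha> j = lx j + LX j *v px j + lbar_xu j *v q j + transpose (fx j) *v lam (j+1)" for j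
  define \<beta> where "\<beta> j = lu j + lbar_ux j *v px j + lbar_uu j *v q j + transpose (fu j) *v lam (j+1)" for j
  define \<kappa> where "\<kappa> = grad lT (xi T) + hess lT (xi T) *v px T"

  \<comment> \<open>Reconciles the row-vector weights of the barred Hessians with the column form;
    this uses symmetry of \<open>S\<close>.\<close>
  have wS: "w (j+1) v* matrix_inv (Q (j+1)) = S (j+1) *v w (j+1)" if "j < T" for j
    using S_sym[OF that] by (metis S_def transpose_matrix_vector)
  have F12: "F1 xi ui a b + F2 xi ui px q a b =
      (\<Sum>j<T. a j \<bullet> \<alpha> j + b j \<bullet> \<beta> j - a (j+1) \<bullet> lam (j+1)) + a T \<bullet> \<kappa>" for a b
    unfolding \<kappa>_def
    by (rule F1_plus_F2[where r=w and Lxu=lbar_xu];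
        (erule w | simp only: fx fu lx lu lam_Suc \<alpha>_def \<beta>_def LX_def lbar_xu lbar_ux lbar_uu wS))

  \<comment> \<open>The last rows as multiplier equations\<close>
  define K where "K z = - 1 / (2 * \<mu>) * ((xpart z 0 - xhat) \<bullet> (matrix_inv P *v (xpart z 0 - xhat)))
       - 1 / (2 * \<mu>) * (\<Sum>j=1..t. (y j - h j (xpart z j)) \<bullet> (matrix_inv (R j) *v (y j - h j (xpart z j))))"
    for z :: "('nx, 'nu) coord \<Rightarrow> real"
  have J_eq: "?J z = F (xpart z) (controls t up z) + K z" for z
    by (simp add: J_def F_def K_def S_def controls_def Let_def)
  \<comment> \<open>A coordinate in the last rows is a state strictly after \<open>t\<close> or a
    control, so it leaves the states in \<open>K\<close> unchanged.\<close>
  have K: "K (z(c := s)) = K z" if "c \<in> last_rows T t" for c z s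
  proof -
    have "xpart (z(c := s)) j = xpart z j" if "j \<le> t" for j
      using \<open>c \<in> last_rows T t\<close> that by (auto simp: xpart_fun_upd xpart_indicator last_rows_def)
    then show ?thesis
      unfolding K_def by simp
  qed
  have ctrl: "controls t up (stack xi ui) = ui"
    using ui_past by (auto simp: controls_def fun_eq_iff)
  have row: "(\<Sum>d\<in>variables T t. hessian ?J (stack xi ui) c d * stack px pu d) = - gradient ?J (stack xi ui) c
      \<longleftrightarrow> (\<Sum>j<T. xpart (indicator {c}) j \<bullet> \<alpha> j + upart (indicator {c}) j \<bullet> \<beta> j
            - xpart (indicator {c}) (j+1) \<bullet> lam (j+1)) + xpart (indicator {c}) T \<bullet> \<kappa> = 0"
    if "c \<in> last_rows T t" for c
  proof -
    have c: "c \<in> variables T t"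
      using that last_rows_subset by blast
    have q: "(\<lambda>j. if t \<le> j then upart (stack px pu) j else 0) = q"
      by (simp add: q_def fun_eq_iff)
    let ?a = "xpart (indicator {c})" and ?b = "upart (indicator {c})"
    have "(\<Sum>d\<in>variables T t. hessian ?J (stack xi ui) c d * stack px pu d) = F2 xi ui px q ?a ?b"
      using hessian_row[OF J_eq c K[OF that], of "stack xi ui" "stack px pu"] by (simp only: ctrl q xpart_stack)
    moreover have "gradient ?J (stack xi ui) c = F1 xi ui ?a ?b"
      using partial_deriv_eq[OF J_eq c K[OF that], of "stack xi ui"] by (simp only: gradient_def ctrl xpart_stack)
    ultimately show ?thesis
      using F12[of ?a ?b] by linarith
  qed
  \<comment> \<open>The scalar rows of each block are collected into one vector equation.\<close>
  have rows: "(\<forall>c\<in>last_rows T t. (\<Sum>d\<in>variables T t. hessian ?J (stack xi ui) c d * stack px pu d)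
        = - gradient ?J (stack xi ui) c)
     \<longleftrightarrow> (\<forall>k. t < k \<and> k \<le> T \<longrightarrow> lam k = (if k = T then \<kappa> else \<alpha> k)) \<and> (\<forall>k. t \<le> k \<and> k < T \<longrightarrow> \<beta> k = 0)"
    (is "?L \<longleftrightarrow> ?M \<and> ?N")
  proof -
    define X where "X c \<longleftrightarrow> (\<Sum>j<T. xpart (indicator {c}) j \<bullet> \<alpha> j + upart (indicator {c}) j \<bullet> \<beta> j
            - xpart (indicator {c}) (j+1) \<bullet> lam (j+1)) + xpart (indicator {c}) T \<bullet> \<kappa> = 0" for c
    have x: "X (XC k i) \<longleftrightarrow> lam k $ i = (if k = T then \<kappa> else \<alpha> k) $ i" if "t < k \<and> k \<le> T" for k i
      unfolding X_def by (subst sum_xpart_indicator_state) (use that in auto)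
    have u: "X (UC k i) \<longleftrightarrow> \<beta> k $ i = 0" if "t \<le> k \<and> k < T" for k i
      unfolding X_def by (subst sum_upart_indicator_control) (use that in auto)
    have "?L \<longleftrightarrow> (\<forall>c\<in>last_rows T t. X c)"
      unfolding X_def by (intro ball_cong refl row)
    also have "\<dots> \<longleftrightarrow> (\<forall>k. t < k \<and> k \<le> T \<longrightarrow> (\<forall>i. X (XC k i))) \<and> (\<forall>k. t \<le> k \<and> k < T \<longrightarrow> (\<forall>i. X (UC k i)))"
      by (rule ball_last_rows)
    also have "\<dots> \<longleftrightarrow> ?M \<and> ?N"
      by (simp only: x u vec_eq_iff zero_index cong: imp_cong)
    finally show ?thesis .
  qed

  \<comment> \<open>Symmetry along the backward recursion\<close>
  have L_sym: "transpose (LX k) = LX k" "transpose (lbar_uu k) = lbar_uu k" if "k < T" for k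
  proof -
    interpret smooth_stage "l k" "l1 k" "l2 k" "f k" "f1 k" "f2 k" "(xi k, ui k)" \<mu> "S (k+1) *v w (k+1)"
      using l12 f12 that by (simp add: smooth_stage_def)
    show "transpose (LX k) = LX k" "transpose (lbar_uu k) = lbar_uu k"
      using Lxx_symmetric Luu_symmetric by (simp_all only: LX_def lbar_uu[OF that] wS[OF that] Lxx_def Luu_def)
  qed
  \<comment> \<open>For \<open>t < k\<close> the measurement indicator is off. This range suffices,
    since every stage from \<open>t\<close> on refers only to \<open>V (k+1)\<close>.\<close>
  have V_later: "V k = LX k + transpose (fx k) ** matrix_inv (\<Gamma> (k+1)) ** V (k+1) ** fx k + transpose (Qux k) ** G k"
    if "t < k" "k < T" for k
    using that by (simp add: V lbar_xx LX_def wS[simplified])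
  have V_sym: "transpose (V k) = V k" if "t < k" "k \<le> T" for k
    using that(2,1)
  proof (induction rule: inc_induct)
    case base
    show ?case
      unfolding V_T by (rule symmetric_matrixI) (simp only: inner_hess[OF lT12] smooth_map.symmetric[OF lT12])
  next
    case (step k)
    then have k: "t \<le> k" "k < T"
      by auto
    have "transpose (V (k+1)) = V (k+1)"
      using step by simp
    from riccati_symmetric[OF this Q_sym[OF k(2)] \<Gamma>[OF k] \<Gamma>_inv[OF k] Quu[OF k] Quu_inv[OF k] L_sym(2,1)[OF k(2)]]
    show ?case
      unfolding V_later[OF \<open>t < k\<close> k(2)] G[OF k] by blast
  qed

  \<comment> \<open>Elimination at one stage\<close>
  have state: "lam (k+1) = V (k+1) *v px (k+1) + v (k+1) \<longleftrightarrow>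
      px (k+1) = matrix_inv (mat 1 - \<mu> *\<^sub>R (Q (k+1) ** V (k+1))) *v
        (fx k *v px k + fu k *v pu k + \<mu> *\<^sub>R (Q (k+1) *v v (k+1)) - w (k+1))"
    and multiplier: "lam (k+1) = V (k+1) *v px (k+1) + v (k+1) \<Longrightarrow>
      lam (k+1) = matrix_inv (\<Gamma> (k+1)) *v (V (k+1) *v (fx k *v px k + fu k *v pu k - w (k+1)) + v (k+1))"
    if k: "t \<le> k" "k < T" for k
  proof -
    have V1: "transpose (V (k+1)) = V (k+1)"
      using V_sym k by simp
    have lam: "lam (k+1) = (1/\<mu>) *\<^sub>R (matrix_inv (Q (k+1)) *v (w (k+1) + (px (k+1) - (fx k *v px k + fu k *v pu k))))"
      using k by (simp add: lam_Suc[simplified] S_def q_def)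
    note facts = Q_inv[OF k(2)] \<Gamma>[OF k] \<Gamma>_inv[OF k]
    show "lam (k+1) = V (k+1) *v px (k+1) + v (k+1) \<longleftrightarrow>
      px (k+1) = matrix_inv (mat 1 - \<mu> *\<^sub>R (Q (k+1) ** V (k+1))) *v
        (fx k *v px k + fu k *v pu k + \<mu> *\<^sub>R (Q (k+1) *v v (k+1)) - w (k+1))"
      by (rule multiplier_affine_iff[OF V1 Q_sym[OF k(2)] facts _ lam]) (use \<open>0 < \<mu>\<close> in simp)
    show "lam (k+1) = matrix_inv (\<Gamma> (k+1)) *v (V (k+1) *v (fx k *v px k + fu k *v pu k - w (k+1)) + v (k+1))"
      if "lam (k+1) = V (k+1) *v px (k+1) + v (k+1)"
      by (rule multiplier_eq[OF facts _ lam that]) (use \<open>0 < \<mu>\<close> in simp)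
  qed
  have control: "\<beta> k = 0 \<longleftrightarrow> pu k = G k *v px k + g k"
    if k: "t \<le> k" "k < T" and "lam (k+1) = V (k+1) *v px (k+1) + v (k+1)" for k
    using control_row_iff[OF Quu[OF k] Qux[OF k] Qu[OF k] multiplier[OF k that(3)] Quu_inv[OF k]]
    by (simp only: \<beta>_def q_def k if_True G g)
  have costate: "\<alpha> k = V k *v px k + v k"
    if "t < k" "k < T" and "lam (k+1) = V (k+1) *v px (k+1) + v (k+1)" and pu: "pu k = G k *v px k + g k" for k
  proof -
    have k: "t \<le> k" "k < T"
      using that by auto
    have V1: "transpose (V (k+1)) = V (k+1)"
      using V_sym k by simp
    \<comment> \<open>Here the coefficient of the control in the state row is matched with
      \<open>Qux\<close>: \<open>lbar_ux\<close> is the transpose of \<open>lbar_xu\<close>, and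
      transposing the gain term exchanges \<open>fu\<close> and \<open>fx\<close>.\<close>
    have "transpose (Qux k) = lbar_xu k + transpose (fx k) ** matrix_inv (\<Gamma> (k+1)) ** V (k+1) ** fu k"
      by (simp only: Qux[OF k] lbar_ux[OF k(2)] transpose_add transpose_transpose
          transpose_gain_congruence[OF V1 Q_sym[OF k(2)] \<Gamma>[OF k] \<Gamma>_inv[OF k]])
    from state_row_eq[OF this V_later[OF that(1,2)] v[OF k] multiplier[OF k that(3)] pu]
    show ?thesis
      by (simp only: \<alpha>_def q_def k if_True)
  qed
  have terminal: "\<kappa> = V T *v px T + v T"
    by (simp add: \<kappa>_def V_T v_T)

  \<comment> \<open>The two directions of the equivalence\<close>
  show ?thesis
    unfolding rows
  proof safe
    assume x_rows: "\<forall>k. t < k \<and> k \<le> T \<longrightarrow> lam k = (if k = T then \<kappa> else \<alpha> k)"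
      and u_rows: "\<forall>k. t \<le> k \<and> k < T \<longrightarrow> \<beta> k = 0"
    have affine: "lam k = V k *v px k + v k" if "t < k" "k \<le> T" for k
      using that(2,1)
    proof (induction rule: inc_induct)
      case base
      then show ?case
        using x_rows terminal by simp
    next
      case (step k)
      then have "lam (k+1) = V (k+1) *v px (k+1) + v (k+1)"
        by simp
      \<comment> \<open>The relation at k + 1 makes the row at the control a feedback law; that law
        turns \<alpha> into the affine expression at \<open>k\<close>, and the state row, available
        since \<open>t < k\<close>, equates it with \<open>lam k\<close>.\<close>
      with step control[of k] costate[of k] x_rows u_rows show ?case
        by simp
    qed
    fix k assume k: "t \<le> k" "k < T"
    have *: "lam (k+1) = V (k+1) *v px (k+1) + v (k+1)"
      using affine k by simp
    show "pu k = G k *v px k + g k"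
      using control[OF k *] u_rows k by blast
    show "px (k+1) = matrix_inv (mat 1 - \<mu> *\<^sub>R (Q (k+1) ** V (k+1))) *v
        (fx k *v px k + fu k *v pu k + \<mu> *\<^sub>R (Q (k+1) *v v (k+1)) - w (k+1))"
      using state[OF k] * by blast
  next
    assume steps: "\<forall>k. t \<le> k \<and> k < T \<longrightarrow> pu k = G k *v px k + g k \<and>
        px (k+1) = matrix_inv (mat 1 - \<mu> *\<^sub>R (Q (k+1) ** V (k+1))) *v
          (fx k *v px k + fu k *v pu k + \<mu> *\<^sub>R (Q (k+1) *v v (k+1)) - w (k+1))"
    have affine: "lam (k+1) = V (k+1) *v px (k+1) + v (k+1)" if "t \<le> k" "k < T" for k
      using state[OF that] steps that by blast
    show "lam k = (if k = T then \<kappa> else \<alpha> k)" if "t < k" "k \<le> T" for k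
    proof -
      have "lam k = V k *v px k + v k"
        using affine[of "k-1"] that by simp
      \<comment> \<open>The affine form of \<alpha> at \<open>k\<close> uses the relation at k + 1,
        so the last state is covered by \<open>terminal\<close> instead.\<close>
      moreover have "\<alpha> k = V k *v px k + v k" if "k < T"
        using costate[OF \<open>t < k\<close> that] affine[of k] steps \<open>t < k\<close> that by simp
      ultimately show ?thesis
        using terminal that by auto
    qed
    show "\<beta> k = 0" if "t \<le> k" "k < T" for k
      using control[OF that affine[OF that]] steps that by blast
  qed
qed

end
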